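(* Let $\psi:G\to H$ be an abstract (not necessarily continuous) group homomorphism from a Lie group $G$ into a topological group $H$ such that (1) the Lie algebra $\operatorname{Lie}(G)$ is perfect, and (2) there exists a compact spacious set $C\subseteq G$ whose image $\psi(C)\subseteq H$ has compact closure in $H$. Then $\psi$ is continuous.
   Context: All topological spaces and groups are Hausdorff. A Lie group is a locally compact group which is a smooth (finite dimensional) real manifold with smooth multiplication and inversion; no countability assumption is imposed. A Lie algebra is perfect if it is spanned by its commutators. Spacious: a subset $C$ of a topological group $G$ is spacious if some product of finitely many left translates of $CC^{-1}$ has nonempty interior, i.e. if there are $r\ge 1$ and $g_1,\dots,g_r\in G$ such that $g_1CC^{-1}g_2CC^{-1}\cdots g_rCC^{-1}$ has nonempty interior (equivalently, the $g_i$ may be chosen such that this product is an identity neighborhood). *)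

theory Defs
  imports "HOL-Analysis.Analysis"
begin

(* Topological groups are rendered by the class topological_group_add, which does not assume
   commutativity.  Hence a + b, - a, 0 stand for the product, the inverse and the neutral element
   of a possibly nonabelian group, and a - b stands for a b^{-1}. *)

section \<open>Smooth maps\<close>

text \<open>\<open>Ck_on k S f\<close> is the usual notion of a $C^k$ map for open \<open>S\<close> only.  In finite dimension, a
  differentiable map is $C^{k+1}$ iff each of its directional derivatives is $C^k$.\<close>

primrec Ck_on :: "nat \<Rightarrow> 'a::euclidean_space set \<Rightarrow> ('a \<Rightarrow> 'b::real_normed_vector) \<Rightarrow> bool" where
  "Ck_on 0 S f \<longleftrightarrow> continuous_on S f"
| "Ck_on (Suc k) S f \<longleftrightarrow>
     (\<forall>x\<in>S. f differentiable (at x)) \<and> (\<forall>v. Ck_on k S (\<lambda>x. frechet_derivative f (at x) v))"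

text \<open>Smoothness on an arbitrary subset: locally, \<open>f\<close> extends to a smooth map on an open set.
  It is needed below for relatively open subsets of a linear subspace, where this agrees with
  smoothness in the sense of that subspace.\<close>

definition smooth_on :: "'a::euclidean_space set \<Rightarrow> ('a \<Rightarrow> 'b::real_normed_vector) \<Rightarrow> bool" where
  "smooth_on S f \<longleftrightarrow>
     (\<forall>x\<in>S. \<exists>T F. open T \<and> x \<in> T \<and> (\<forall>k. Ck_on k T F) \<and> (\<forall>y\<in>S \<inter> T. F y = f y))"

section \<open>Smooth manifolds\<close>

text \<open>A chart is a pair of an open set \<open>U\<close> and a map that is a homeomorphism from \<open>U\<close> onto a relatively
  open subset of the model space \<open>V\<close>.  The model space is a linear subspace of a Euclidean space
  rather than a whole type because types of class \<open>euclidean_space\<close> have positive dimension: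
  \<open>V = {0}\<close> gives the manifolds of dimension 0, i.e. the discrete spaces.\<close>

type_synonym ('g, 'e) chart = "'g set \<times> ('g \<Rightarrow> 'e)"

definition is_chart :: "'e::euclidean_space set \<Rightarrow> ('g::topological_space, 'e) chart \<Rightarrow> bool" where
  "is_chart V = (\<lambda>(U, \<phi>). open U \<and> openin (top_of_set V) (\<phi> ` U) \<and>
     homeomorphism U (\<phi> ` U) \<phi> (inv_into U \<phi>))"

definition smooth_atlas ::
    "'e::euclidean_space set \<Rightarrow> ('g::topological_space, 'e) chart set \<Rightarrow> bool" where
  "smooth_atlas V A \<longleftrightarrow>
     (\<forall>c\<in>A. is_chart V c) \<and> (\<Union>(U, \<phi>)\<in>A. U) = UNIV \<and>
     (\<forall>(U, \<phi>)\<in>A. \<forall>(W, \<kappa>)\<in>A. smooth_on (\<phi> ` (U \<inter> W)) (\<kappa> \<circ> inv_into U \<phi>))"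

definition smooth_fun ::
    "('g::topological_space, 'e::euclidean_space) chart set \<Rightarrow> ('g \<Rightarrow> real) \<Rightarrow> bool" where
  "smooth_fun A f \<longleftrightarrow> (\<forall>(U, \<phi>)\<in>A. smooth_on (\<phi> ` U) (f \<circ> inv_into U \<phi>))"

text \<open>Smooth curves through \<open>p\<close>; only the restriction to some interval around 0 matters.\<close>

definition smooth_curve_at ::
    "('g::topological_space, 'e::euclidean_space) chart set \<Rightarrow> 'g \<Rightarrow> (real \<Rightarrow> 'g) \<Rightarrow> bool" where
  "smooth_curve_at A p c \<longleftrightarrow> c 0 = p \<and>
     (\<exists>\<epsilon>>0. continuous_on {-\<epsilon><..<\<epsilon>} c \<and>
       (\<forall>(U, \<phi>)\<in>A. smooth_on {t\<in>{-\<epsilon><..<\<epsilon>}. c t \<in> U} (\<phi> \<circ> c)))"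

text \<open>Tangent vectors at \<open>p\<close> are the velocities of smooth curves through \<open>p\<close>, acting on smooth
  functions.  An operator on smooth functions is made a total function by letting it
  vanish on all other functions.\<close>

definition tangent_space ::
    "('g::topological_space, 'e::euclidean_space) chart set \<Rightarrow> 'g \<Rightarrow> (('g \<Rightarrow> real) \<Rightarrow> real) set" where
  "tangent_space A p =
     {(\<lambda>f. if smooth_fun A f then deriv (f \<circ> c) 0 else 0) | c. smooth_curve_at A p c}"

type_synonym 'g vector_field = "('g \<Rightarrow> real) \<Rightarrow> ('g \<Rightarrow> real)"

definition smooth_vector_fields ::
    "('g::topological_space, 'e::euclidean_space) chart set \<Rightarrow> 'g vector_field set" where
  "smooth_vector_fields A =
     {X. (\<forall>p. (\<lambda>f. X f p) \<in> tangent_space A p) \<and> (\<forall>f. smooth_fun A f \<longrightarrow> smooth_fun A (X f))}"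

section \<open>Lie groups and their Lie algebras\<close>

definition lie_group ::
    "'e::euclidean_space set \<Rightarrow> ('g::{topological_group_add,t2_space}, 'e) chart set \<Rightarrow> bool" where
  "lie_group V A \<longleftrightarrow>
     locally compact (UNIV :: 'g set) \<and> subspace V \<and> smooth_atlas V A \<and>
     (\<forall>(U, \<phi>)\<in>A. \<forall>(U', \<phi>')\<in>A. \<forall>(W, \<kappa>)\<in>A.
        smooth_on {(\<phi> x, \<phi>' y) | x y. x \<in> U \<and> y \<in> U' \<and> x + y \<in> W}
          (\<lambda>(a, b). \<kappa> (inv_into U \<phi> a + inv_into U' \<phi>' b))) \<and>
     (\<forall>(U, \<phi>)\<in>A. \<forall>(W, \<kappa>)\<in>A.
        smooth_on (\<phi> ` {x\<in>U. - x \<in> W}) (\<lambda>a. \<kappa> (- inv_into U \<phi> a)))"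

definition lie_algebra ::
    "('g::{topological_group_add,t2_space}, 'e::euclidean_space) chart set \<Rightarrow> 'g vector_field set" where
  "lie_algebra A =
     {X \<in> smooth_vector_fields A. \<forall>g f. X (\<lambda>x. f (g + x)) = (\<lambda>x. X f (g + x))}"

definition lie_bracket :: "'g vector_field \<Rightarrow> 'g vector_field \<Rightarrow> 'g vector_field" where
  "lie_bracket X Y = (\<lambda>f p. X (Y f) p - Y (X f) p)"

text \<open>\<open>L\<close> is the linear span of its commutators.\<close>

definition perfect_lie_algebra :: "'g vector_field set \<Rightarrow> bool" where
  "perfect_lie_algebra L \<longleftrightarrow>
     L = {(\<lambda>f p. \<Sum>i<n. a i * lie_bracket (X i) (Y i) f p) | (n::nat) (a :: nat \<Rightarrow> real) X Y.
            \<forall>i<n. X i \<in> L \<and> Y i \<in> L}"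

section \<open>Spacious sets\<close>

text \<open>The sum over the list is the ordered product of the sets $g_i C C^{-1}$.  The set of inverses
  is \<open>uminus ` C\<close>; the term \<open>- C\<close> would be the complement.\<close>

definition spacious :: "'g::topological_group_add set \<Rightarrow> bool" where
  "spacious C \<longleftrightarrow>
     (\<exists>gs. gs \<noteq> [] \<and> interior (sum_list (map (\<lambda>g. g +o (C + uminus ` C)) gs)) \<noteq> {})"

end

theory Submission
  imports Defs
begin

text \<open>Some set with nonempty interior, hence some neighborhood \<open>K\<close> of the neutral element, has
  relatively compact image.  By compactness, for \<open>\<psi> b\<close> close to 0 the whole set
  \<open>{[\<psi> a, \<psi> b] | a. a \<in> K}\<close> is close to 0, and the set \<open>B\<close> of these \<open>b\<close> is dense in some neighborhood of 0,
  since finitely many translates of \<open>B\<close> cover \<open>K\<close>.  So it suffices that finite sums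
  of commutators \<open>[a, b]\<close> with \<open>a \<in> K\<close> and \<open>b \<in> B\<close> fill a neighborhood of 0.  The derivative of
  \<open>a \<mapsto> [a, b]\<close> at 0 is \<open>1 - Ad b\<close>, so by the open mapping theorem this holds if the ranges of these
  operators span the tangent space.  Otherwise a nonzero functional \<open>l\<close> vanishes on all of them; by density,
  it does so for all \<open>b\<close> near 0, and differentiating in \<open>b\<close> shows that \<open>l\<close> vanishes on all
  commutators of the Lie algebra, which is impossible if the latter is perfect.\<close>

section \<open>Calculus of smooth maps\<close>

text \<open>The set \<open>B\<close> is a preimage under an arbitrary homomorphism, so density near
  0 is all that is known of it and nothing can be varied continuously inside it. Hence the second
  entries of the commutators are frozen at finitely many chosen \<open>b\<close>, and only the first
  entries move, through the open set \<open>K\<close>. As they all start at 0, every commutator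
  starts at 0, and the derivatives of the commutators add up although the group is not commutative.
  The number of summands must not depend on \<open>B\<close>: first a neighborhood is chosen that
  absorbs sums of that many terms, then a smaller one for the images of the \<open>b\<close>, and
  only this determines \<open>B\<close>. A basis of the tangent space extracted from the ranges of
  the operators \<open>1 - Ad b\<close> settles this, with exactly \<open>dim V\<close> summands.
  The bracket enters through second derivatives of the multiplication: if \<open>l\<close> kills
  \<open>1 - Ad b\<close> for all \<open>b\<close> near 0, then differentiating in \<open>b\<close>
  makes the mixed second derivative of the multiplication at 0, seen through \<open>l\<close>, a
  symmetric bilinear form, so that \<open>X (Y f)\<close> and \<open>Y (X f)\<close> agree at 0 for
  a function \<open>f\<close> with differential \<open>l\<close>.\<close>

lemma Ck_on_subset: "Ck_on k S f \<Longrightarrow> T \<subseteq> S \<Longrightarrow> Ck_on k T f"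
  by (induction k arbitrary: f) (auto intro: continuous_on_subset)

lemma Ck_on_SucD: "Ck_on (Suc k) S f \<Longrightarrow> Ck_on k S f"
proof (induction k arbitrary: f)
  case 0
  then show ?case
    by (auto intro!: continuous_at_imp_continuous_on differentiable_imp_continuous_within)
next
  case (Suc k)
  then show ?case by simp
qed

lemma frechet_derivative_transform_open:
  assumes "open S" "x \<in> S" "\<And>y. y \<in> S \<Longrightarrow> f y = g y" "f differentiable (at x)"
  shows "g differentiable (at x)" "frechet_derivative g (at x) = frechet_derivative f (at x)"
proof -
  have "(f has_derivative frechet_derivative f (at x)) (at x)"
    using assms(4) by (simp add: frechet_derivative_works)
  then have "(g has_derivative frechet_derivative f (at x)) (at x)"
    using assms(1-3) has_derivative_transform_within_open by blast
  then show "g differentiable (at x)" "frechet_derivative g (at x) = frechet_derivative f (at x)"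
    by (auto simp: differentiable_def dest: frechet_derivative_at[symmetric])
qed

text \<open>Derivatives of all orders depend only on germs, and on an open set equality of values is
  equality of germs.\<close>

lemma Ck_on_cong:
  assumes "open S" "\<And>x. x \<in> S \<Longrightarrow> f x = g x" "Ck_on k S f"
  shows "Ck_on k S g"
  using assms(2,3)
proof (induction k arbitrary: f g)
  case 0
  then show ?case by (metis Ck_on.simps(1) continuous_on_cong)
next
  case (Suc k)
  have d: "g differentiable (at x)" "frechet_derivative g (at x) = frechet_derivative f (at x)"
    if "x \<in> S" for x
    using frechet_derivative_transform_open[OF assms(1) that, of f g] Suc.prems that by auto
  have "Ck_on k S (\<lambda>x. frechet_derivative g (at x) v)" for v
    by (rule Suc.IH[of "\<lambda>x. frechet_derivative f (at x) v"]) (use d Suc.prems in auto)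
  then show ?case using d by simp
qed

lemma Ck_on_SucI:
  assumes "open S" "\<And>x. x \<in> S \<Longrightarrow> (f has_derivative f' x) (at x)"
    and "\<And>v. Ck_on k S (\<lambda>x. f' x v)"
  shows "Ck_on (Suc k) S f"
proof -
  have "Ck_on k S (\<lambda>x. frechet_derivative f (at x) v)" for v
    by (rule Ck_on_cong[OF assms(1) _ assms(3)[of v]]) (use assms(2) frechet_derivative_at in metis)
  then show ?thesis using assms(2) by (auto simp: differentiable_def)
qed

lemma Ck_on_SucE:
  assumes "Ck_on (Suc k) S f" "x \<in> S"
  shows "(f has_derivative frechet_derivative f (at x)) (at x)"
  using assms by (simp add: frechet_derivative_works)

lemma Ck_on_local:
  assumes "\<And>x. x \<in> S \<Longrightarrow> \<exists>T. open T \<and> x \<in> T \<and> Ck_on k (S \<inter> T) f"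
  shows "Ck_on k S f"
  using assms
proof (induction k arbitrary: f)
  case 0
  have "continuous (at x within S) f" if x: "x \<in> S" for x
  proof -
    obtain T where T: "open T" "x \<in> T" "continuous_on (S \<inter> T) f" using 0 x by auto
    then have "continuous (at x within S \<inter> T) f"
      using x by (simp add: continuous_on_eq_continuous_within)
    moreover have "at x within S \<inter> T = at x within S"
      by (rule at_within_nhd[of x T]) (use T in auto)
    ultimately show ?thesis by simp
  qed
  then show ?case by (simp add: continuous_on_eq_continuous_within)
next
  case (Suc k)
  have "f differentiable (at x)" if "x \<in> S" for x using Suc.prems[OF that] that by auto
  moreover have "Ck_on k S (\<lambda>x. frechet_derivative f (at x) v)" for v
    by (rule Suc.IH) (use Suc.prems in \<open>force\<close>)
  ultimately show ?case by simp
qed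

lemma Ck_on_const: "open S \<Longrightarrow> Ck_on k S (\<lambda>x. c)"
proof (induction k arbitrary: c)
  case (Suc k)
  show ?case by (rule Ck_on_SucI[where f'="\<lambda>x v. 0"]) (use Suc in auto)
qed simp

lemma Ck_on_bounded_linear:
  assumes "open S" "bounded_linear h" shows "Ck_on k S h"
proof (cases k)
  case (Suc n)
  show ?thesis unfolding Suc
    by (rule Ck_on_SucI[where f'="\<lambda>x. h"])
      (use assms Ck_on_const in \<open>auto intro: bounded_linear_imp_has_derivative\<close>)
qed (use assms linear_continuous_on in auto)

lemma Ck_on_linear_compose:
  assumes "open S" "bounded_linear h" "Ck_on k S f"
  shows "Ck_on k S (\<lambda>x. h (f x))"
  using assms(3)
proof (induction k arbitrary: f)
  case 0
  then show ?case using assms(2) by (simp add: bounded_linear.continuous_on)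
next
  case (Suc k)
  show ?case
    by (rule Ck_on_SucI[where f'="\<lambda>x v. h (frechet_derivative f (at x) v)"])
      (use assms Suc in \<open>auto simp: frechet_derivative_works intro: bounded_linear.has_derivative\<close>)
qed

lemma Ck_on_add:
  assumes "open S" "Ck_on k S f" "Ck_on k S g"
  shows "Ck_on k S (\<lambda>x. f x + g x)"
  using assms(2,3)
proof (induction k arbitrary: f g)
  case 0
  then show ?case by (auto intro: continuous_intros)
next
  case (Suc k)
  show ?case
    by (rule Ck_on_SucI[where f'="\<lambda>x v. frechet_derivative f (at x) v + frechet_derivative g (at x) v"])
      (use assms(1) Suc in \<open>auto simp: frechet_derivative_works intro: has_derivative_add\<close>)
qed

lemma Ck_on_sum:
  assumes "open S" "\<And>i. i \<in> I \<Longrightarrow> Ck_on k S (f i)"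
  shows "Ck_on k S (\<lambda>x. \<Sum>i\<in>I. f i x)"
  using assms(2)
  by (induction I rule: infinite_finite_induct) (auto intro!: Ck_on_add Ck_on_const assms(1))

lemma Ck_on_bilinear:
  assumes "open S" "bounded_bilinear h" "Ck_on k S f" "Ck_on k S g"
  shows "Ck_on k S (\<lambda>x. h (f x) (g x))"
  using assms(3,4)
proof (induction k arbitrary: f g)
  case 0
  then show ?case using assms(2) by (auto intro: bounded_bilinear.continuous_on)
next
  case (Suc k)
  show ?case
  proof (rule Ck_on_SucI[where f'="\<lambda>x v. h (f x) (frechet_derivative g (at x) v) + h (frechet_derivative f (at x) v) (g x)"])
    show "((\<lambda>x. h (f x) (g x)) has_derivative
          (\<lambda>v. h (f x) (frechet_derivative g (at x) v) + h (frechet_derivative f (at x) v) (g x))) (at x)"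
      if "x \<in> S" for x
      by (rule bounded_bilinear.FDERIV[OF assms(2)]) (use Suc.prems Ck_on_SucE that in auto)
    show "Ck_on k S (\<lambda>x. h (f x) (frechet_derivative g (at x) v) + h (frechet_derivative f (at x) v) (g x))" for v
      by (intro Ck_on_add Suc.IH assms(1)) (use Suc.prems Ck_on_SucD in auto)
  qed (rule assms(1))
qed

text \<open>Separates direction and base point: a derivative whose direction varies with the point
  becomes a finite sum of products in which only the fixed basis directions are differentiated
  along.\<close>

lemma frechet_derivative_Basis_sum:
  fixes f :: "'a::euclidean_space \<Rightarrow> 'b::real_normed_vector"
  assumes "f differentiable (at x)"
  shows "frechet_derivative f (at x) v = (\<Sum>i\<in>Basis. (v \<bullet> i) *\<^sub>R frechet_derivative f (at x) i)"
proof -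
  have "linear (frechet_derivative f (at x))" using assms linear_frechet_derivative by blast
  then have "frechet_derivative f (at x) (\<Sum>i\<in>Basis. (v \<bullet> i) *\<^sub>R i)
     = (\<Sum>i\<in>Basis. (v \<bullet> i) *\<^sub>R frechet_derivative f (at x) i)"
    by (simp add: linear_sum linear_cmul)
  then show ?thesis by (simp add: euclidean_representation)
qed

text \<open>In the chain rule the outer derivative is taken in a direction depending on
  \<open>x\<close>. Expanded over the basis, it is a sum of scalar factors times composites of
  \<open>g\<close> with \<open>C^k\<close> functions, to which the induction hypothesis applies;
  this is why \<open>f\<close> is generalized.\<close>

lemma Ck_on_compose:
  fixes g :: "'a::euclidean_space \<Rightarrow> 'b::euclidean_space"
    and f :: "'b \<Rightarrow> 'c::real_normed_vector"
  assumes "open S" "Ck_on k S g" "Ck_on k T f" "g ` S \<subseteq> T"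
  shows "Ck_on k S (\<lambda>x. f (g x))"
  using assms(2,3)
proof (induction k arbitrary: f)
  case 0
  then show ?case using assms(4) continuous_on_compose2 by (metis Ck_on.simps(1))
next
  case (Suc k)
  show ?case
  proof (rule Ck_on_SucI[where f'="\<lambda>x v. frechet_derivative f (at (g x)) (frechet_derivative g (at x) v)"])
    show "((\<lambda>x. f (g x)) has_derivative
          (\<lambda>v. frechet_derivative f (at (g x)) (frechet_derivative g (at x) v))) (at x)" if "x \<in> S" for x
      by (rule has_derivative_compose[of g _ x UNIV f])
       (use Suc.prems assms(4) that in \<open>auto simp flip: frechet_derivative_works\<close>)
    show "Ck_on k S (\<lambda>x. frechet_derivative f (at (g x)) (frechet_derivative g (at x) v))" for v
    proof (rule Ck_on_cong[OF assms(1)])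
      show "Ck_on k S (\<lambda>x. \<Sum>i\<in>Basis. (frechet_derivative g (at x) v \<bullet> i) *\<^sub>R frechet_derivative f (at (g x)) i)"
        by (intro Ck_on_sum Ck_on_bilinear[OF _ bounded_bilinear_scaleR] assms(1) Suc.IH
            Ck_on_linear_compose[OF _ bounded_linear_inner_left])
          (use Suc.prems Ck_on_SucD in auto)
      show "(\<Sum>i\<in>Basis. (frechet_derivative g (at x) v \<bullet> i) *\<^sub>R frechet_derivative f (at (g x)) i)
           = frechet_derivative f (at (g x)) (frechet_derivative g (at x) v)" if "x \<in> S" for x
        by (rule frechet_derivative_Basis_sum[symmetric]) (use Suc.prems assms(4) that in auto)
    qed
  qed (rule assms(1))
qed

lemma Ck_on_Pair:
  assumes "open S" "Ck_on k S f" "Ck_on k S g"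
  shows "Ck_on k S (\<lambda>x. (f x, g x))"
proof -
  have "Ck_on k S (\<lambda>x. (f x, 0) + (0, g x))"
    by (intro Ck_on_add Ck_on_linear_compose[of S "\<lambda>y. (y, 0)"] Ck_on_linear_compose[of S "\<lambda>y. (0, y)"] assms
        bounded_linear_intros)
  then show ?thesis by simp
qed

section \<open>Smooth maps on arbitrary sets\<close>

lemma smooth_onE:
  assumes "smooth_on S f" "x \<in> S"
  obtains T F where "open T" "x \<in> T" "\<forall>k. Ck_on k T F" "\<forall>y\<in>S \<inter> T. F y = f y"
  using assms unfolding smooth_on_def by blast

text \<open>A local extension agrees with \<open>f\<close> on \<open>S \<inter> T\<close>, which is
  open because \<open>S\<close> is; so the derivatives agree there as well, and the local statements
  glue.\<close>

lemma smooth_on_open: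
  assumes "open S"
  shows "smooth_on S f \<longleftrightarrow> (\<forall>k. Ck_on k S f)"
proof
  assume *: "smooth_on S f"
  show "\<forall>k. Ck_on k S f"
  proof
    fix k
    show "Ck_on k S f"
    proof (rule Ck_on_local)
      fix x assume "x \<in> S"
      with * obtain T F where T: "open T" "x \<in> T" "\<forall>k. Ck_on k T F" "\<forall>y\<in>S \<inter> T. F y = f y"
        by (rule smooth_onE)
      then have "Ck_on k (S \<inter> T) f"
        using Ck_on_cong[of "S \<inter> T" F f k] Ck_on_subset[of k T F "S \<inter> T"] assms by (simp add: open_Int)
      then show "\<exists>T. open T \<and> x \<in> T \<and> Ck_on k (S \<inter> T) f" using T by auto
    qed
  qed
next
  assume *: "\<forall>k. Ck_on k S f"
  show "smooth_on S f" unfolding smooth_on_def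
    by (rule ballI, rule exI[of _ S], rule exI[of _ f]) (simp add: * assms)
qed

lemma smooth_on_subset:
  assumes "smooth_on S f" "T \<subseteq> S"
  shows "smooth_on T f"
  unfolding smooth_on_def
proof
  fix x assume "x \<in> T"
  with assms(2) have "x \<in> S" by auto
  with assms(1) obtain U F where *: "open U" "x \<in> U" "\<forall>k. Ck_on k U F" "\<forall>y\<in>S \<inter> U. F y = f y"
    by (rule smooth_onE)
  show "\<exists>U F. open U \<and> x \<in> U \<and> (\<forall>k. Ck_on k U F) \<and> (\<forall>y\<in>T \<inter> U. F y = f y)"
    by (rule exI[of _ U], rule exI[of _ F]) (use * assms(2) in auto)
qed

lemma smooth_on_cong:
  assumes "smooth_on S f" "\<And>x. x \<in> S \<Longrightarrow> f x = g x"
  shows "smooth_on S g"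
  unfolding smooth_on_def
proof
  fix x assume "x \<in> S"
  with assms(1) obtain U F where *: "open U" "x \<in> U" "\<forall>k. Ck_on k U F" "\<forall>y\<in>S \<inter> U. F y = f y"
    by (rule smooth_onE)
  show "\<exists>U F. open U \<and> x \<in> U \<and> (\<forall>k. Ck_on k U F) \<and> (\<forall>y\<in>S \<inter> U. F y = g y)"
    by (rule exI[of _ U], rule exI[of _ F]) (use * assms(2) in auto)
qed

lemma smooth_on_local:
  assumes "\<And>x. x \<in> S \<Longrightarrow> \<exists>T. open T \<and> x \<in> T \<and> smooth_on (S \<inter> T) f"
  shows "smooth_on S f"
  unfolding smooth_on_def
proof
  fix x assume "x \<in> S"
  then obtain T where T: "open T" "x \<in> T" "smooth_on (S \<inter> T) f" using assms by blast
  have "x \<in> S \<inter> T" using \<open>x \<in> S\<close> T by simp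
  with T(3) obtain T' F where T': "open T'" "x \<in> T'" "\<forall>k. Ck_on k T' F" "\<forall>y\<in>S \<inter> T \<inter> T'. F y = f y"
    by (rule smooth_onE)
  have "\<forall>k. Ck_on k (T \<inter> T') F" using T'(3) Ck_on_subset by blast
  show "\<exists>T F. open T \<and> x \<in> T \<and> (\<forall>k. Ck_on k T F) \<and> (\<forall>y\<in>S \<inter> T. F y = f y)"
    by (rule exI[of _ "T \<inter> T'"], rule exI[of _ F]) (use T T' \<open>\<forall>k. Ck_on k (T \<inter> T') F\<close> in auto)
qed

lemma smooth_on_const: "smooth_on S (\<lambda>x. c)"
  by (rule smooth_on_subset[of UNIV]) (auto simp: smooth_on_open Ck_on_const)

lemma smooth_on_bounded_linear: "bounded_linear h \<Longrightarrow> smooth_on S h"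
  by (rule smooth_on_subset[of UNIV]) (auto simp: smooth_on_open Ck_on_bounded_linear)

lemma smooth_on_common_extension:
  assumes "smooth_on S f" "smooth_on S g" "x \<in> S"
  obtains T F G where "open T" "x \<in> T" "\<forall>k. Ck_on k T F" "\<forall>k. Ck_on k T G"
    "\<And>y. y \<in> S \<inter> T \<Longrightarrow> F y = f y" "\<And>y. y \<in> S \<inter> T \<Longrightarrow> G y = g y"
proof -
  obtain T1 F where T1: "open T1" "x \<in> T1" "\<forall>k. Ck_on k T1 F" "\<forall>y\<in>S \<inter> T1. F y = f y"
    using assms(1,3) by (rule smooth_onE)
  obtain T2 G where T2: "open T2" "x \<in> T2" "\<forall>k. Ck_on k T2 G" "\<forall>y\<in>S \<inter> T2. G y = g y"
    using assms(2,3) by (rule smooth_onE)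
  show thesis
    by (rule that[of "T1 \<inter> T2" F G]) (use T1 T2 in \<open>auto intro: Ck_on_subset\<close>)
qed

lemma smooth_on_Pair:
  assumes "smooth_on S f" "smooth_on S g"
  shows "smooth_on S (\<lambda>x. (f x, g x))"
  unfolding smooth_on_def
proof
  fix x assume "x \<in> S"
  obtain T F G where *: "open T" "x \<in> T" "\<forall>k. Ck_on k T F" "\<forall>k. Ck_on k T G"
    "\<And>y. y \<in> S \<inter> T \<Longrightarrow> F y = f y" "\<And>y. y \<in> S \<inter> T \<Longrightarrow> G y = g y"
    by (rule smooth_on_common_extension[OF assms \<open>x \<in> S\<close>]) blast
  show "\<exists>T F. open T \<and> x \<in> T \<and> (\<forall>k. Ck_on k T F) \<and> (\<forall>y\<in>S \<inter> T. F y = (f y, g y))"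
    by (rule exI[of _ T], rule exI[of _ "\<lambda>x. (F x, G x)"]) (use * in \<open>auto intro: Ck_on_Pair\<close>)
qed

lemma smooth_on_compose:
  fixes g :: "'a::euclidean_space \<Rightarrow> 'b::euclidean_space"
    and f :: "'b \<Rightarrow> 'c::real_normed_vector"
  assumes "smooth_on S g" "smooth_on T f" "g ` S \<subseteq> T"
  shows "smooth_on S (\<lambda>x. f (g x))"
  unfolding smooth_on_def
proof
  fix x assume "x \<in> S"
  obtain T1 G where T1: "open T1" "x \<in> T1" "\<forall>k. Ck_on k T1 G" "\<forall>y\<in>S \<inter> T1. G y = g y"
    using assms(1) \<open>x \<in> S\<close> by (rule smooth_onE)
  have "g x \<in> T" using assms(3) \<open>x \<in> S\<close> by auto
  with assms(2) obtain T2 F where T2: "open T2" "g x \<in> T2" "\<forall>k. Ck_on k T2 F" "\<forall>y\<in>T \<inter> T2. F y = f y"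
    by (rule smooth_onE)
  \<comment> \<open>The extension \<open>G\<close> may leave \<open>T\<close> outside
    \<open>S\<close>, but only the domain \<open>T2\<close> of the extension of \<open>f\<close>
    matters.\<close>
  let ?T = "T1 \<inter> G -` T2"
  have "continuous_on T1 G" using T1(3) Ck_on.simps(1) by blast
  then have o: "open ?T" using T1(1) T2(1) by (metis continuous_open_preimage)
  have "Ck_on k ?T (\<lambda>y. F (G y))" for k
    by (rule Ck_on_compose[OF o, of _ _ T2]) (use T1 T2 in \<open>auto intro: Ck_on_subset\<close>)
  moreover have "F (G y) = f (g y)" if "y \<in> S \<inter> ?T" for y
    using that T1(4) T2(4) assms(3) by (metis Int_iff image_subset_iff vimageE)
  moreover have "x \<in> ?T" using T1 T2 \<open>x \<in> S\<close> by auto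
  ultimately show "\<exists>T F. open T \<and> x \<in> T \<and> (\<forall>k. Ck_on k T F) \<and> (\<forall>y\<in>S \<inter> T. F y = f (g y))"
    using o by (intro exI[of _ ?T] exI[of _ "\<lambda>y. F (G y)"]) auto
qed

lemma smooth_on_linear_compose:
  assumes "bounded_linear h" "smooth_on S f"
  shows "smooth_on S (\<lambda>x. h (f x))"
  unfolding smooth_on_def
proof
  fix x assume "x \<in> S"
  with assms(2) obtain T F where *: "open T" "x \<in> T" "\<forall>k. Ck_on k T F" "\<forall>y\<in>S \<inter> T. F y = f y"
    by (rule smooth_onE)
  show "\<exists>T F. open T \<and> x \<in> T \<and> (\<forall>k. Ck_on k T F) \<and> (\<forall>y\<in>S \<inter> T. F y = h (f y))"
    by (rule exI[of _ T], rule exI[of _ "\<lambda>x. h (F x)"]) (use * in \<open>auto intro: Ck_on_linear_compose[OF _ assms(1)]\<close>)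
qed

lemma smooth_on_bilinear:
  assumes "bounded_bilinear h" "smooth_on S f" "smooth_on S g"
  shows "smooth_on S (\<lambda>x. h (f x) (g x))"
  unfolding smooth_on_def
proof
  fix x assume "x \<in> S"
  obtain T F G where *: "open T" "x \<in> T" "\<forall>k. Ck_on k T F" "\<forall>k. Ck_on k T G"
    "\<And>y. y \<in> S \<inter> T \<Longrightarrow> F y = f y" "\<And>y. y \<in> S \<inter> T \<Longrightarrow> G y = g y"
    by (rule smooth_on_common_extension[OF assms(2,3) \<open>x \<in> S\<close>]) blast
  show "\<exists>T F. open T \<and> x \<in> T \<and> (\<forall>k. Ck_on k T F) \<and> (\<forall>y\<in>S \<inter> T. F y = h (f y) (g y))"
    by (rule exI[of _ T], rule exI[of _ "\<lambda>x. h (F x) (G x)"]) (use * in \<open>auto intro: Ck_on_bilinear[OF _ assms(1)]\<close>)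
qed

lemma smooth_on_add:
  assumes "smooth_on S f" "smooth_on S g"
  shows "smooth_on S (\<lambda>x. f x + g x)"
  using smooth_on_linear_compose[OF bounded_linear_add[OF bounded_linear_fst bounded_linear_snd]
      smooth_on_Pair[OF assms]] by simp

lemma smooth_on_diff:
  assumes "smooth_on S f" "smooth_on S g"
  shows "smooth_on S (\<lambda>x. f x - g x)"
  using smooth_on_linear_compose[OF bounded_linear_sub[OF bounded_linear_fst bounded_linear_snd]
      smooth_on_Pair[OF assms]] by simp

lemma smooth_on_imp_continuous_on:
  assumes "smooth_on S f" shows "continuous_on S f"
proof -
  have "continuous (at x within S) f" if x: "x \<in> S" for x
  proof -
    obtain T F where T: "open T" "x \<in> T" "\<forall>k. Ck_on k T F" "\<forall>y\<in>S \<inter> T. F y = f y"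
      using assms x by (rule smooth_onE)
    then have "continuous_on T F" using Ck_on.simps(1) by blast
    then have "continuous_on (S \<inter> T) F" by (rule continuous_on_subset) auto
    then have "continuous_on (S \<inter> T) f" using T(4) by (metis continuous_on_cong)
    then have "continuous (at x within S \<inter> T) f"
      using x T(2) by (simp add: continuous_on_eq_continuous_within)
    moreover have "at x within S \<inter> T = at x within S"
      by (rule at_within_nhd[of x T]) (use T in auto)
    ultimately show ?thesis by simp
  qed
  then show ?thesis by (simp add: continuous_on_eq_continuous_within)
qed

lemma smooth_on_differentiable:
  assumes "open S" "smooth_on S f" "x \<in> S"
  shows "f differentiable (at x)"
  using assms smooth_on_open[of S f] Ck_on.simps(2) by blast

lemma smooth_on_frechet_derivative:
  assumes "open S" "smooth_on S f"
  shows "smooth_on S (\<lambda>x. frechet_derivative f (at x) v)"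
  using assms smooth_on_open[of S] Ck_on.simps(2) by blast

text \<open>Makes the partial differentials of the group operations depend smoothly on the base
  point and on the direction.\<close>

lemma smooth_on_frechet_derivative_param:
  fixes f :: "'a::euclidean_space \<Rightarrow> 'b::real_normed_vector"
    and g w :: "'c::euclidean_space \<Rightarrow> 'a"
  assumes S: "open S" "smooth_on S f" and g: "smooth_on T g" "g ` T \<subseteq> S" and w: "smooth_on T w"
  shows "smooth_on T (\<lambda>x. frechet_derivative f (at (g x)) (w x))"
proof -
  have "smooth_on T (\<lambda>x. (w x \<bullet> i) *\<^sub>R frechet_derivative f (at (g x)) i)" for i
    by (intro smooth_on_bilinear[OF bounded_bilinear_scaleR] smooth_on_linear_compose[OF bounded_linear_inner_left]
        smooth_on_compose[OF g(1) _ g(2)] smooth_on_frechet_derivative S w)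
  then have "smooth_on T (\<lambda>x. \<Sum>i\<in>I. (w x \<bullet> i) *\<^sub>R frechet_derivative f (at (g x)) i)" for I
    by (induction I rule: infinite_finite_induct) (auto intro: smooth_on_add smooth_on_const)
  from this[of Basis] show ?thesis
  proof (rule smooth_on_cong)
    fix x assume "x \<in> T"
    then show "(\<Sum>i\<in>Basis. (w x \<bullet> i) *\<^sub>R frechet_derivative f (at (g x)) i)
       = frechet_derivative f (at (g x)) (w x)"
      using frechet_derivative_Basis_sum smooth_on_differentiable[OF S] g(2) by (metis image_subset_iff)
  qed
qed

lemma deriv_along_line:
  fixes F :: "'a::real_normed_vector \<Rightarrow> real"
  assumes "F differentiable (at x)"
  shows "((\<lambda>t. F (x + t *\<^sub>R v)) has_real_derivative frechet_derivative F (at x) v) (at 0)"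
proof -
  have l: "((\<lambda>t. x + t *\<^sub>R v) has_derivative (\<lambda>t. t *\<^sub>R v)) (at 0)"
    by (auto intro!: derivative_eq_intros)
  have "(F has_derivative frechet_derivative F (at x)) (at (x + 0 *\<^sub>R v))"
    using assms by (simp add: frechet_derivative_works)
  from has_derivative_compose[OF l this]
  have "((\<lambda>t. F (x + t *\<^sub>R v)) has_derivative (\<lambda>t. frechet_derivative F (at x) (t *\<^sub>R v))) (at 0)" by simp
  moreover have "frechet_derivative F (at x) (t *\<^sub>R v) = frechet_derivative F (at x) v * t" for t
    using linear_cmul[OF linear_frechet_derivative[OF assms], of t v] by simp
  ultimately show ?thesis by (simp add: has_field_derivative_def)
qed

text \<open>\<open>S\<close> need not be open, as images of charts are only relatively open in the
  model space. Since short segments in the last variable stay in \<open>S\<close>, the derivative in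
  direction \<open>(0, 1)\<close> of any smooth extension is the desired one.\<close>

lemma smooth_on_deriv_param:
  fixes f :: "'a::euclidean_space \<times> real \<Rightarrow> real"
  assumes f: "smooth_on S f"
    and S0: "\<And>a. a \<in> S0 \<Longrightarrow> \<exists>\<epsilon>>0. \<forall>t. \<bar>t\<bar> < \<epsilon> \<longrightarrow> (a, t) \<in> S"
  shows "smooth_on S0 (\<lambda>a. deriv (\<lambda>t. f (a, t)) 0)"
  unfolding smooth_on_def
proof
  fix a assume a: "a \<in> S0"
  then have "(a, 0) \<in> S" using S0 by fastforce
  with f obtain T F where T: "open T" "(a, 0) \<in> T" "\<forall>k. Ck_on k T F" "\<forall>y\<in>S \<inter> T. F y = f y"
    by (rule smooth_onE)
  let ?T = "(\<lambda>a. (a, 0)) -` T"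
  let ?G = "\<lambda>a. frechet_derivative F (at (a, 0)) (0, 1)"
  have o: "open ?T" by (intro open_vimage T continuous_intros)
  have F: "smooth_on T F" using T smooth_on_open by blast
  have "smooth_on ?T ?G"
    by (rule smooth_on_frechet_derivative_param[OF T(1) F])
      (auto intro!: smooth_on_Pair smooth_on_const smooth_on_bounded_linear bounded_linear_Pair bounded_linear_ident bounded_linear_zero)
  then have "\<forall>k. Ck_on k ?T ?G" using o smooth_on_open by blast
  moreover have "?G y = deriv (\<lambda>t. f (y, t)) 0" if y: "y \<in> S0 \<inter> ?T" for y
  proof -
    have "((\<lambda>t. F ((y, 0) + t *\<^sub>R (0, 1))) has_real_derivative ?G y) (at 0)"
      by (rule deriv_along_line) (use smooth_on_differentiable[OF T(1) F] y in auto)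
    then have 1: "((\<lambda>t. F (y, t)) has_real_derivative ?G y) (at 0)" by simp
    have "((\<lambda>t. f (y, t)) has_real_derivative ?G y) (at 0)"
    proof (rule DERIV_cong_ev[OF refl _ refl, THEN iffD1, OF _ 1])
      obtain \<epsilon> where e: "\<epsilon> > 0" "\<forall>t. \<bar>t\<bar> < \<epsilon> \<longrightarrow> (y, t) \<in> S" using S0 y by auto
      have "open ((\<lambda>t. (y, t)) -` T \<inter> {-\<epsilon><..<\<epsilon>})"
        by (intro open_Int open_vimage T continuous_intros open_greaterThanLessThan)
      moreover have "0 \<in> (\<lambda>t. (y, t)) -` T \<inter> {-\<epsilon><..<\<epsilon>}" using y e by auto
      moreover have "F (y, t) = f (y, t)" if "t \<in> (\<lambda>t. (y, t)) -` T \<inter> {-\<epsilon><..<\<epsilon>}" for t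
        using that e T(4) by (auto simp: abs_less_iff)
      ultimately show "\<forall>\<^sub>F t in nhds 0. F (y, t) = f (y, t)"
        unfolding eventually_nhds by blast
    qed
    then show ?thesis by (simp add: DERIV_imp_deriv)
  qed
  ultimately show "\<exists>T F. open T \<and> a \<in> T \<and> (\<forall>k. Ck_on k T F) \<and> (\<forall>y\<in>S0 \<inter> T. F y = deriv (\<lambda>t. f (y, t)) 0)"
    using o T(2) by (intro exI[of _ ?T] exI[of _ ?G]) auto
qed

section \<open>Bump functions\<close>

text \<open>The classical flat function is the case \<open>k = 0\<close>; the powers of
  \<open>1 / t\<close> are included so that the span of the family is closed under
  differentiation.\<close>

definition flat_exp :: "nat \<Rightarrow> real \<Rightarrow> real" where
  "flat_exp k t = (if t > 0 then (1 / t) ^ k * exp (- 1 / t) else 0)"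

text \<open>On the right, substitute the inverse of \<open>t\<close>: the exponential beats every
  power at infinity.\<close>

lemma flat_exp_tendsto_0: "(flat_exp k \<longlongrightarrow> 0) (at 0)"
proof (rule filterlim_split_at)
  show "(flat_exp k \<longlongrightarrow> 0) (at_left 0)"
    by (rule tendsto_eventually) (auto simp: flat_exp_def eventually_at_filter)
  have "((\<lambda>t. (inverse t) ^ k / exp (inverse t)) \<longlongrightarrow> (0::real)) (at_right 0)"
    by (rule filterlim_compose[OF tendsto_power_div_exp_0 filterlim_inverse_at_top_right])
  then show "(flat_exp k \<longlongrightarrow> 0) (at_right 0)"
    by (rule Lim_transform_eventually)
      (auto simp: flat_exp_def eventually_at_filter exp_minus field_simps)
qed

lemma flat_exp_has_derivative:
  "(flat_exp k has_real_derivative flat_exp (k + 2) t - real k * flat_exp (k + 1) t) (at t)"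
proof (cases t "0::real" rule: linorder_cases)
  case less
  have "((\<lambda>t. 0) has_real_derivative 0) (at t)" by simp
  then have "(flat_exp k has_real_derivative 0) (at t)"
    by (rule has_field_derivative_transform_within_open[of _ _ _ "{..<0}"]) (use less in \<open>auto simp: flat_exp_def\<close>)
  then show ?thesis using less by (simp add: flat_exp_def)
next
  case equal
  \<comment> \<open>The difference quotient of \<open>flat_exp k\<close> at 0 is
    \<open>flat_exp (Suc k)\<close> itself.\<close>
  have "((\<lambda>h. (flat_exp k (0 + h) - flat_exp k 0) / h) \<longlongrightarrow> 0) (at 0)"
    by (rule Lim_transform_eventually[OF flat_exp_tendsto_0[of "Suc k"]])
      (auto simp: flat_exp_def eventually_at_filter)
  then have "(flat_exp k has_real_derivative 0) (at 0)" by (simp add: DERIV_def)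
  then show ?thesis using equal by (simp add: flat_exp_def)
next
  case greater
  have "((\<lambda>t. (1 / t) ^ k * exp (- 1 / t)) has_real_derivative
     (1 / t) ^ (k + 2) * exp (- 1 / t) - real k * ((1 / t) ^ (k + 1) * exp (- 1 / t))) (at t)"
    by (rule derivative_eq_intros refl | use greater in \<open>force\<close>)+
       (cases k; use greater in \<open>simp add: field_simps power2_eq_square\<close>)
  then have "((\<lambda>t. (1 / t) ^ k * exp (- 1 / t)) has_real_derivative
     flat_exp (k + 2) t - real k * flat_exp (k + 1) t) (at t)"
    using greater by (simp add: flat_exp_def)
  then show ?thesis
    by (rule has_field_derivative_transform_within_open[of _ _ _ "{0<..}"]) (use greater in \<open>auto simp: flat_exp_def\<close>)
qed

lemma smooth_on_flat_exp: "smooth_on S (flat_exp k)"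
proof -
  have "Ck_on n UNIV (flat_exp k)" for n
  proof (induction n arbitrary: k)
    case 0
    show ?case
      using DERIV_continuous[OF flat_exp_has_derivative] by (simp add: continuous_at_imp_continuous_on)
  next
    case (Suc n)
    show ?case
    proof (rule Ck_on_SucI)
      show "(flat_exp k has_derivative (*) (flat_exp (k + 2) t - real k * flat_exp (k + 1) t)) (at t)" for t
        using flat_exp_has_derivative by (simp add: has_field_derivative_def)
      have "Ck_on n UNIV (\<lambda>t. v * flat_exp (k + 2) t + (- real k * v) * flat_exp (k + 1) t)" for v
        by (intro Ck_on_add Ck_on_linear_compose[OF _ bounded_linear_mult_right] Suc.IH) auto
      then show "Ck_on n UNIV (\<lambda>t. (flat_exp (k + 2) t - real k * flat_exp (k + 1) t) * v)" for v
        by (simp add: algebra_simps)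
    qed simp
  qed
  then have "smooth_on UNIV (flat_exp k)" by (simp add: smooth_on_open)
  then show ?thesis by (rule smooth_on_subset) simp
qed

text \<open>The flat function is applied twice, once to level off inside and once to cut off
  outside. This avoids dividing by a nonconstant function.\<close>

lemma smooth_bump:
  fixes r :: real
  assumes "r > 0"
  obtains b :: "'a::euclidean_space \<Rightarrow> real" and s where "smooth_on UNIV b" "s > 0"
    "\<And>x. norm x < s \<Longrightarrow> b x = 1" "\<And>x. norm x \<ge> r \<Longrightarrow> b x = 0"
proof -
  \<comment> \<open>\<open>\<delta>\<close> is the value of the inner flat function on the sphere of
    radius \<open>r\<close>. By monotonicity the argument of the outer one is
    \<open>\<delta>\<close> on the ball of radius \<open>r/2\<close> and at most 0 outside radius
    \<open>r\<close>.\<close>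
  define \<delta> where "\<delta> = flat_exp 0 (r\<^sup>2 - (r/2)\<^sup>2)"
  define b :: "'a \<Rightarrow> real" where
    "b x = 1 / flat_exp 0 \<delta> * flat_exp 0 (\<delta> - flat_exp 0 (x \<bullet> x - (r/2)\<^sup>2))" for x
  have pos: "r\<^sup>2 - (r/2)\<^sup>2 > 0" using assms by (simp add: power2_eq_square)
  then have "\<delta> > 0" by (simp add: \<delta>_def flat_exp_def)
  have sm: "smooth_on S (\<lambda>x. flat_exp 0 (h x))" if "smooth_on S h" for S and h :: "'a \<Rightarrow> real"
    by (rule smooth_on_compose[OF that smooth_on_flat_exp[of UNIV]]) simp
  have "smooth_on UNIV b" unfolding b_def
    by (intro smooth_on_linear_compose[OF bounded_linear_mult_right] sm smooth_on_diff smooth_on_const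
        smooth_on_bilinear[OF bounded_bilinear_inner] smooth_on_bounded_linear bounded_linear_ident)
  moreover have "b x = 1" if "norm x < r/2" for x
  proof -
    have "x \<bullet> x - (r/2)\<^sup>2 \<le> 0"
      using power_mono[of "norm x" "r/2" 2] that by (simp add: dot_square_norm)
    then have "flat_exp 0 (x \<bullet> x - (r/2)\<^sup>2) = 0" by (simp add: flat_exp_def)
    then show ?thesis using \<open>\<delta> > 0\<close> by (simp add: b_def flat_exp_def)
  qed
  moreover have "b x = 0" if "norm x \<ge> r" for x
  proof -
    have "r\<^sup>2 - (r/2)\<^sup>2 \<le> x \<bullet> x - (r/2)\<^sup>2"
      using power_mono[of r "norm x" 2] that assms by (simp add: dot_square_norm)
    then have "\<delta> \<le> flat_exp 0 (x \<bullet> x - (r/2)\<^sup>2)"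
      using pos by (auto simp: \<delta>_def flat_exp_def intro: frac_le)
    then show ?thesis by (simp add: b_def flat_exp_def)
  qed
  ultimately show thesis using that[of b "r/2"] assms by auto
qed

section \<open>Smooth maps into Lie groups\<close>

text \<open>This is the condition in \<open>smooth_curve_at\<close> with the interval replaced by
  any subset of a Euclidean space, so that families of group elements with several parameters are
  covered.\<close>

definition smooth_into ::
    "('g::topological_space, 'e::euclidean_space) chart set \<Rightarrow> 'a::euclidean_space set \<Rightarrow> ('a \<Rightarrow> 'g) \<Rightarrow> bool" where
  "smooth_into A S h \<longleftrightarrow>
     continuous_on S h \<and> (\<forall>(U, \<phi>)\<in>A. smooth_on {x\<in>S. h x \<in> U} (\<phi> \<circ> h))"

lemma smooth_curve_at_iff:
  "smooth_curve_at A p c \<longleftrightarrow> c 0 = p \<and> (\<exists>\<epsilon>>0. smooth_into A {-\<epsilon><..<\<epsilon>} c)"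
  by (simp add: smooth_curve_at_def smooth_into_def)

lemma smooth_intoI:
  assumes "continuous_on S h"
    and "\<And>U \<phi>. (U, \<phi>) \<in> A \<Longrightarrow> smooth_on {x\<in>S. h x \<in> U} (\<lambda>x. \<phi> (h x))"
  shows "smooth_into A S h"
  unfolding smooth_into_def o_def using assms by blast

lemma smooth_intoD:
  assumes "smooth_into A S h"
  shows "continuous_on S h"
    and "(U, \<phi>) \<in> A \<Longrightarrow> smooth_on {x\<in>S. h x \<in> U} (\<lambda>x. \<phi> (h x))"
  using assms unfolding smooth_into_def o_def by blast+

lemma smooth_into_subset:
  assumes "smooth_into A S h" "T \<subseteq> S"
  shows "smooth_into A T h"
proof (rule smooth_intoI)
  show "continuous_on T h" using smooth_intoD(1)[OF assms(1)] assms(2) continuous_on_subset by blast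
  show "smooth_on {x\<in>T. h x \<in> U} (\<lambda>x. \<phi> (h x))" if "(U, \<phi>) \<in> A" for U \<phi>
    by (rule smooth_on_subset[OF smooth_intoD(2)[OF assms(1) that]]) (use assms(2) in auto)
qed

lemma smooth_into_const: "smooth_into A S (\<lambda>x. p)"
  by (rule smooth_intoI) (auto intro: smooth_on_const)

lemma smooth_into_compose:
  assumes "smooth_into A S h" "smooth_on T g" "g ` T \<subseteq> S"
  shows "smooth_into A T (\<lambda>x. h (g x))"
proof (rule smooth_intoI)
  show "continuous_on T (\<lambda>x. h (g x))"
    by (rule continuous_on_compose2[OF smooth_intoD(1)[OF assms(1)] smooth_on_imp_continuous_on[OF assms(2)] assms(3)])
  show "smooth_on {x\<in>T. h (g x) \<in> U} (\<lambda>x. \<phi> (h (g x)))" if "(U, \<phi>) \<in> A" for U \<phi>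
    by (rule smooth_on_compose[OF smooth_on_subset[OF assms(2)] smooth_intoD(2)[OF assms(1) that]])
      (use assms(3) in auto)
qed

lemma continuous_on_open_nbhd:
  assumes "continuous_on S h" "open U"
  obtains T where "open T" "S \<inter> T = {x\<in>S. h x \<in> U}"
proof -
  obtain T where "open T" "T \<inter> S = h -` U \<inter> S"
    using assms by (metis continuous_on_open_invariant)
  then show thesis using that[of T] by blast
qed

context
  fixes V :: "'e::euclidean_space set"
    and A :: "('g::{topological_group_add,t2_space}, 'e) chart set"
  assumes G: "lie_group V A"
begin

lemma chart_open: "(U, \<phi>) \<in> A \<Longrightarrow> open U"
  and chart_image_openin: "(U, \<phi>) \<in> A \<Longrightarrow> openin (top_of_set V) (\<phi> ` U)"
  and chart_homeomorphism: "(U, \<phi>) \<in> A \<Longrightarrow> homeomorphism U (\<phi> ` U) \<phi> (inv_into U \<phi>)"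
  using G by (auto simp: lie_group_def smooth_atlas_def is_chart_def)

lemma chart_inv: "(U, \<phi>) \<in> A \<Longrightarrow> x \<in> U \<Longrightarrow> inv_into U \<phi> (\<phi> x) = x"
  using chart_homeomorphism by (simp add: homeomorphism_def)

lemma lie_group_add:
  assumes "(U, \<phi>) \<in> A" "(U', \<phi>') \<in> A" "(W, \<kappa>) \<in> A"
  shows "smooth_on {(\<phi> x, \<phi>' y) | x y. x \<in> U \<and> y \<in> U' \<and> x + y \<in> W}
          (\<lambda>(a, b). \<kappa> (inv_into U \<phi> a + inv_into U' \<phi>' b))"
proof -
  have "\<forall>(U, \<phi>)\<in>A. \<forall>(U', \<phi>')\<in>A. \<forall>(W, \<kappa>)\<in>A.
        smooth_on {(\<phi> x, \<phi>' y) | x y. x \<in> U \<and> y \<in> U' \<and> x + y \<in> W}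
          (\<lambda>(a, b). \<kappa> (inv_into U \<phi> a + inv_into U' \<phi>' b))"
    using G unfolding lie_group_def by (elim conjE)
  from this[THEN bspec, OF assms(1), unfolded split, THEN bspec, OF assms(2), unfolded split,
      THEN bspec, OF assms(3)] show ?thesis by (simp only: split)
qed

lemma lie_group_minus:
  assumes "(U, \<phi>) \<in> A" "(W, \<kappa>) \<in> A"
  shows "smooth_on (\<phi> ` {x\<in>U. - x \<in> W}) (\<lambda>a. \<kappa> (- inv_into U \<phi> a))"
proof -
  have "\<forall>(U, \<phi>)\<in>A. \<forall>(W, \<kappa>)\<in>A. smooth_on (\<phi> ` {x\<in>U. - x \<in> W}) (\<lambda>a. \<kappa> (- inv_into U \<phi> a))"
    using G unfolding lie_group_def by (elim conjE)
  from this[THEN bspec, OF assms(1), unfolded split, THEN bspec, OF assms(2)]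
  show ?thesis by (simp only: split)
qed

lemma chart_at: obtains U \<phi> where "(U, \<phi>) \<in> A" "x \<in> U"
proof -
  have "x \<in> (\<Union>(U, \<phi>)\<in>A. U)" using G by (simp add: lie_group_def smooth_atlas_def)
  then show thesis using that by auto
qed

lemma smooth_into_chart_inv:
  assumes "(U, \<phi>) \<in> A"
  shows "smooth_into A (\<phi> ` U) (inv_into U \<phi>)"
proof (rule smooth_intoI)
  show "continuous_on (\<phi> ` U) (inv_into U \<phi>)"
    using chart_homeomorphism[OF assms] by (simp add: homeomorphism_def)
  show "smooth_on {x\<in>\<phi> ` U. inv_into U \<phi> x \<in> W} (\<lambda>x. \<kappa> (inv_into U \<phi> x))" if W: "(W, \<kappa>) \<in> A" for W \<kappa>
  proof -
    have "{x\<in>\<phi> ` U. inv_into U \<phi> x \<in> W} = \<phi> ` (U \<inter> W)"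
      using chart_inv[OF assms] by auto
    moreover have "\<forall>(U, \<phi>)\<in>A. \<forall>(W, \<kappa>)\<in>A. smooth_on (\<phi> ` (U \<inter> W)) (\<kappa> \<circ> inv_into U \<phi>)"
      using G unfolding lie_group_def smooth_atlas_def by (elim conjE)
    from this[THEN bspec, OF assms, unfolded split, THEN bspec, OF W, unfolded split]
    have "smooth_on (\<phi> ` (U \<inter> W)) (\<kappa> \<circ> inv_into U \<phi>)" .
    ultimately show ?thesis by (simp add: o_def)
  qed
qed

lemma smooth_into_local:
  assumes "continuous_on S h"
    and "\<And>x W \<kappa>. x \<in> S \<Longrightarrow> (W, \<kappa>) \<in> A \<Longrightarrow> h x \<in> W \<Longrightarrow>
        \<exists>T. open T \<and> x \<in> T \<and> smooth_on ({y\<in>S. h y \<in> W} \<inter> T) (\<lambda>y. \<kappa> (h y))"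
  shows "smooth_into A S h"
  by (rule smooth_intoI[OF assms(1)], rule smooth_on_local) (use assms(2) in blast)

text \<open>By continuity, \<open>h\<close> and \<open>h'\<close> each stay in one chart locally.
  There the sum is the coordinate expression of the multiplication composed with the pair of
  coordinate maps.\<close>

lemma smooth_into_add:
  assumes "smooth_into A S h" "smooth_into A S h'"
  shows "smooth_into A S (\<lambda>x. h x + h' x)"
proof (rule smooth_into_local)
  have c: "continuous_on S h" "continuous_on S h'" using assms smooth_intoD(1) by blast+
  then show "continuous_on S (\<lambda>x. h x + h' x)" by (intro continuous_intros)
  fix x W \<kappa> assume x: "x \<in> S" "(W, \<kappa>) \<in> A" "h x + h' x \<in> W"
  obtain U \<phi> where U: "(U, \<phi>) \<in> A" "h x \<in> U" by (rule chart_at)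
  obtain U' \<phi>' where U': "(U', \<phi>') \<in> A" "h' x \<in> U'" by (rule chart_at)
  obtain T where T: "open T" "S \<inter> T = {x\<in>S. h x \<in> U}"
    using c(1) chart_open[OF U(1)] by (rule continuous_on_open_nbhd)
  obtain T' where T': "open T'" "S \<inter> T' = {x\<in>S. h' x \<in> U'}"
    using c(2) chart_open[OF U'(1)] by (rule continuous_on_open_nbhd)
  let ?S = "{y\<in>S. h y + h' y \<in> W} \<inter> (T \<inter> T')"
  have *: "h y \<in> U" "h' y \<in> U'" if "y \<in> ?S" for y
    using that T(2) T'(2) by auto
  have sub: "?S \<subseteq> {y\<in>S. h y \<in> U}" "?S \<subseteq> {y\<in>S. h' y \<in> U'}"
    "(\<lambda>y. (\<phi> (h y), \<phi>' (h' y))) ` ?S \<subseteq> {(\<phi> x, \<phi>' y) | x y. x \<in> U \<and> y \<in> U' \<and> x + y \<in> W}"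
    using * by blast+
  have s1: "smooth_on {(\<phi> x, \<phi>' y) | x y. x \<in> U \<and> y \<in> U' \<and> x + y \<in> W}
          (\<lambda>(a, b). \<kappa> (inv_into U \<phi> a + inv_into U' \<phi>' b))"
    by (rule lie_group_add[OF U(1) U'(1) x(2)])
  have s2: "smooth_on ?S (\<lambda>y. (\<phi> (h y), \<phi>' (h' y)))"
    by (intro smooth_on_Pair smooth_on_subset[OF smooth_intoD(2)[OF assms(1) U(1)]]
        smooth_on_subset[OF smooth_intoD(2)[OF assms(2) U'(1)]] sub)
  have "smooth_on ?S (\<lambda>y. \<kappa> (h y + h' y))"
    by (rule smooth_on_cong[OF smooth_on_compose[OF s2 s1 sub(3)]]) (use * chart_inv[OF U(1)] chart_inv[OF U'(1)] in simp)
  then show "\<exists>T. open T \<and> x \<in> T \<and> smooth_on ({y\<in>S. h y + h' y \<in> W} \<inter> T) (\<lambda>y. \<kappa> (h y + h' y))"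
    by (intro exI[of _ "T \<inter> T'"]) (use T T' x U U' in auto)
qed

lemma smooth_into_minus:
  assumes "smooth_into A S h"
  shows "smooth_into A S (\<lambda>x. - h x)"
proof (rule smooth_into_local)
  have c: "continuous_on S h" using assms smooth_intoD(1) by blast+
  then show "continuous_on S (\<lambda>x. - h x)" by (intro continuous_intros)
  fix x W \<kappa> assume x: "x \<in> S" "(W, \<kappa>) \<in> A" "- h x \<in> W"
  obtain U \<phi> where U: "(U, \<phi>) \<in> A" "h x \<in> U" by (rule chart_at)
  obtain T where T: "open T" "S \<inter> T = {x\<in>S. h x \<in> U}"
    using c chart_open[OF U(1)] by (rule continuous_on_open_nbhd)
  let ?S = "{y\<in>S. - h y \<in> W} \<inter> T"
  have *: "h y \<in> U" if "y \<in> ?S" for y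
    using that T(2) by auto
  have sub: "?S \<subseteq> {y\<in>S. h y \<in> U}" "(\<lambda>y. \<phi> (h y)) ` ?S \<subseteq> \<phi> ` {x\<in>U. - x \<in> W}"
    using * by blast+
  have s1: "smooth_on (\<phi> ` {x\<in>U. - x \<in> W}) (\<lambda>a. \<kappa> (- inv_into U \<phi> a))"
    by (rule lie_group_minus[OF U(1) x(2)])
  have s2: "smooth_on ?S (\<lambda>y. \<phi> (h y))"
    by (intro smooth_on_subset[OF smooth_intoD(2)[OF assms(1) U(1)]] sub)
  have "smooth_on ?S (\<lambda>y. \<kappa> (- h y))"
    by (rule smooth_on_cong[OF smooth_on_compose[OF s2 s1 sub(2)]]) (use * chart_inv[OF U(1)] in simp)
  then show "\<exists>T. open T \<and> x \<in> T \<and> smooth_on ({y\<in>S. - h y \<in> W} \<inter> T) (\<lambda>y. \<kappa> (- h y))"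
    by (intro exI[of _ T]) (use T x U in auto)
qed

lemma smooth_fun_smooth_into:
  assumes "smooth_fun A f" "smooth_into A S h"
  shows "smooth_on S (\<lambda>x. f (h x))"
proof (rule smooth_on_local)
  fix x assume x: "x \<in> S"
  obtain U \<phi> where U: "(U, \<phi>) \<in> A" "h x \<in> U" by (rule chart_at)
  have "continuous_on S h" using assms smooth_intoD(1) by blast+
  then obtain T where T: "open T" "S \<inter> T = {x\<in>S. h x \<in> U}"
    using chart_open[OF U(1)] by (rule continuous_on_open_nbhd)
  have "smooth_on (\<phi> ` U) (\<lambda>a. f (inv_into U \<phi> a))"
    using assms(1) U(1) by (auto simp: smooth_fun_def o_def)
  then have "smooth_on {x\<in>S. h x \<in> U} (\<lambda>y. f (inv_into U \<phi> (\<phi> (h y))))"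
    by (rule smooth_on_compose[OF smooth_intoD(2)[OF assms(2) U(1)]]) auto
  then have "smooth_on (S \<inter> T) (\<lambda>y. f (h y))"
    unfolding T(2) by (rule smooth_on_cong) (use chart_inv[OF U(1)] in simp)
  then show "\<exists>T. open T \<and> x \<in> T \<and> smooth_on (S \<inter> T) (\<lambda>x. f (h x))"
    using T x U by blast
qed

lemma smooth_funI:
  assumes "\<And>U \<phi>. (U, \<phi>) \<in> A \<Longrightarrow> smooth_on (\<phi> ` U) (\<lambda>a. f (inv_into U \<phi> a))"
  shows "smooth_fun A f"
  using assms by (auto simp: smooth_fun_def o_def)

lemma smooth_fun_translate:
  assumes "smooth_fun A f" shows "smooth_fun A (\<lambda>x. f (g + x))"
  by (intro smooth_funI smooth_fun_smooth_into[OF assms] smooth_into_add smooth_into_const smooth_into_chart_inv)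

lemma smooth_fun_translate_iff: "smooth_fun A (\<lambda>x. f (g + x)) \<longleftrightarrow> smooth_fun A f"
proof
  assume "smooth_fun A (\<lambda>x. f (g + x))"
  from smooth_fun_translate[OF this, of "- g"] show "smooth_fun A f" by (simp add: add.assoc[symmetric])
qed (rule smooth_fun_translate)

end

section \<open>A Lie group near the neutral element\<close>

text \<open>The projection \<open>P\<close> onto the model space \<open>V\<close> turns the inverse of the chart into a map \<open>\<xi>\<close> on an open
  set of the whole Euclidean space, where derivatives are unique.\<close>

locale lie_group_chart =
  fixes V :: "'e::euclidean_space set"
    and A :: "('g::{topological_group_add,t2_space}, 'e) chart set"
    and U0 \<phi>0 and P :: "'e \<Rightarrow> 'e"
  assumes G: "lie_group V A" and chart0: "(U0, \<phi>0) \<in> A" and zero_U0: "0 \<in> U0"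
    and P_linear: "linear P" and P_V: "P a \<in> V" and P_id: "a \<in> V \<Longrightarrow> P a = a"
begin

definition \<eta> :: "'g \<Rightarrow> 'e" where "\<eta> x = \<phi>0 x - \<phi>0 0"
definition \<Omega> :: "'e set" where "\<Omega> = {a. \<phi>0 0 + P a \<in> \<phi>0 ` U0}"
definition \<xi> :: "'e \<Rightarrow> 'g" where "\<xi> a = inv_into U0 \<phi>0 (\<phi>0 0 + P a)"

lemma V_subspace: "subspace V" using G by (simp add: lie_group_def)

lemma P_P [simp]: "P (P a) = P a" by (simp add: P_V P_id)

lemma P_bounded_linear: "bounded_linear P"
  using P_linear by (simp add: linear_conv_bounded_linear)

lemma P_0 [simp]: "P 0 = 0" by (rule linear_0[OF P_linear])

lemma U0_open: "open U0" using chart_open[OF G chart0] .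

lemma \<phi>0_V: "x \<in> U0 \<Longrightarrow> \<phi>0 x \<in> V"
  using openin_imp_subset[OF chart_image_openin[OF G chart0]] by auto

lemma \<eta>_V: "x \<in> U0 \<Longrightarrow> \<eta> x \<in> V"
  unfolding \<eta>_def by (intro subspace_diff V_subspace \<phi>0_V zero_U0)

lemma P_\<eta>: "x \<in> U0 \<Longrightarrow> P (\<eta> x) = \<eta> x"
  by (simp add: \<eta>_V P_id)

lemma \<eta>_0 [simp]: "\<eta> 0 = 0" by (simp add: \<eta>_def)

text \<open>The chart image is only relatively open in \<open>V\<close>, say
  \<open>V \<inter> T\<close>. Since \<open>\<phi>0 0 + P a\<close> always lies in \<open>V\<close>,
  membership in \<open>\<Omega>\<close> reduces to an open condition involving \<open>T\<close>
  alone: \<open>\<Omega>\<close> is a cylinder along the kernel of \<open>P\<close>.\<close>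

lemma \<Omega>_open: "open \<Omega>"
proof -
  obtain T where T: "open T" "\<phi>0 ` U0 = V \<inter> T"
    using chart_image_openin[OF G chart0] by (auto simp: openin_open)
  have "\<phi>0 0 + P a \<in> V" for a
    by (intro subspace_add V_subspace \<phi>0_V zero_U0 P_V)
  then have "\<Omega> = (\<lambda>a. \<phi>0 0 + P a) -` T" using T(2) by (auto simp: \<Omega>_def)
  then show ?thesis
    by (simp add: open_vimage T(1) continuous_intros linear_continuous_on[OF P_bounded_linear])
qed

lemma zero_\<Omega>: "0 \<in> \<Omega>" using zero_U0 by (simp add: \<Omega>_def)

lemma \<xi>_U0: "a \<in> \<Omega> \<Longrightarrow> \<xi> a \<in> U0"
  by (simp add: \<Omega>_def \<xi>_def inv_into_into)

lemma \<eta>_\<xi>: "a \<in> \<Omega> \<Longrightarrow> \<eta> (\<xi> a) = P a"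
  by (simp add: \<Omega>_def \<xi>_def \<eta>_def f_inv_into_f)

lemma \<xi>_\<eta>: "x \<in> U0 \<Longrightarrow> \<xi> (\<eta> x) = x"
  using chart_inv[OF G chart0, of x] P_\<eta>[of x] by (simp add: \<xi>_def \<eta>_def)

lemma \<eta>_\<Omega>: "x \<in> U0 \<Longrightarrow> \<eta> x \<in> \<Omega>"
  using P_\<eta>[of x] by (simp add: \<Omega>_def \<eta>_def)

lemma \<xi>_0 [simp]: "\<xi> 0 = 0" using \<xi>_\<eta>[OF zero_U0] by simp

lemma \<xi>_P [simp]: "\<xi> (P a) = \<xi> a" by (simp add: \<xi>_def)

lemma P_\<Omega> [simp]: "P a \<in> \<Omega> \<longleftrightarrow> a \<in> \<Omega>" by (simp add: \<Omega>_def)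

lemma smooth_into_\<xi>: "smooth_into A \<Omega> \<xi>"
proof -
  have "smooth_on \<Omega> (\<lambda>a. \<phi>0 0 + P a)"
    by (intro smooth_on_add smooth_on_const smooth_on_bounded_linear P_bounded_linear)
  from smooth_into_compose[OF smooth_into_chart_inv[OF G chart0] this]
  show ?thesis by (auto simp: \<Omega>_def \<xi>_def[abs_def])
qed

lemma \<xi>_smooth:
  "smooth_on S g \<Longrightarrow> (\<And>x. x \<in> S \<Longrightarrow> g x \<in> \<Omega>) \<Longrightarrow> smooth_into A S (\<lambda>x. \<xi> (g x))"
  by (rule smooth_into_compose[OF smooth_into_\<xi>]) auto

lemma smooth_on_\<eta>:
  assumes "smooth_into A S h" "\<And>x. x \<in> S \<Longrightarrow> h x \<in> U0"
  shows "smooth_on S (\<lambda>x. \<eta> (h x))"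
  unfolding \<eta>_def
proof (intro smooth_on_diff smooth_on_const)
  have "{x \<in> S. h x \<in> U0} = S" using assms(2) by auto
  then show "smooth_on S (\<lambda>x. \<phi>0 (h x))" using smooth_intoD(2)[OF assms(1) chart0] by simp
qed

lemma continuous_on_\<eta>: "continuous_on U0 \<eta>"
  unfolding \<eta>_def using chart_homeomorphism[OF G chart0]
  by (intro continuous_intros) (simp add: homeomorphism_def)

lemma continuous_on_\<xi>: "continuous_on \<Omega> \<xi>"
  by (rule smooth_intoD(1)[OF smooth_into_\<xi>])

lemma open_smooth_domain:
  assumes "open S" "smooth_into A S h" "open U"
  shows "open {x\<in>S. h x \<in> U}"
proof -
  have "{x\<in>S. h x \<in> U} = h -` U \<inter> S" by auto
  then show ?thesis
    using continuous_on_open_vimage[OF assms(1)] smooth_intoD(1)[OF assms(2)] assms(3) by auto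
qed

text \<open>In \<open>comm\<close> the arguments are swapped: \<open>comm (\<beta>, a)\<close> represents \<open>[a, \<beta>]\<close>.  With this convention
  \<open>comm2 \<beta>\<close> below is \<open>1 - Ad \<beta>\<close>, whereas \<open>mul1 \<beta>\<close> and \<open>mul2 \<beta>\<close> are the differentials at 0 of the
  right and the left translation by \<open>\<beta>\<close>.\<close>

definition mul :: "'e \<times> 'e \<Rightarrow> 'e" where
  "mul z = \<eta> (\<xi> (fst z) + \<xi> (snd z))"
definition dom_mul :: "('e \<times> 'e) set" where
  "dom_mul = {z \<in> \<Omega> \<times> \<Omega>. \<xi> (fst z) + \<xi> (snd z) \<in> U0}"
definition comm :: "'e \<times> 'e \<Rightarrow> 'e" where
  "comm z = \<eta> (\<xi> (snd z) + \<xi> (fst z) - \<xi> (snd z) - \<xi> (fst z))"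
definition dom_comm :: "('e \<times> 'e) set" where
  "dom_comm = {z \<in> \<Omega> \<times> \<Omega>. \<xi> (snd z) + \<xi> (fst z) - \<xi> (snd z) - \<xi> (fst z) \<in> U0}"

lemma smooth_\<xi>_fst_snd:
  "smooth_into A (\<Omega> \<times> \<Omega>) (\<lambda>z. \<xi> (fst z))" "smooth_into A (\<Omega> \<times> \<Omega>) (\<lambda>z. \<xi> (snd z))"
  by (auto intro!: \<xi>_smooth smooth_on_bounded_linear bounded_linear_fst bounded_linear_snd)

lemma smooth_into_mul: "smooth_into A (\<Omega> \<times> \<Omega>) (\<lambda>z. \<xi> (fst z) + \<xi> (snd z))"
  by (intro smooth_into_add[OF G] smooth_\<xi>_fst_snd)

lemma smooth_into_comm: "smooth_into A (\<Omega> \<times> \<Omega>) (\<lambda>z. \<xi> (snd z) + \<xi> (fst z) - \<xi> (snd z) - \<xi> (fst z))"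
  unfolding diff_conv_add_uminus
  by (intro smooth_into_add[OF G] smooth_into_minus[OF G] smooth_\<xi>_fst_snd)

lemma dom_mul_open: "open dom_mul"
  unfolding dom_mul_def by (intro open_smooth_domain smooth_into_mul open_Times \<Omega>_open U0_open)

lemma dom_comm_open: "open dom_comm"
  unfolding dom_comm_def by (intro open_smooth_domain smooth_into_comm open_Times \<Omega>_open U0_open)

lemma smooth_mul: "smooth_on dom_mul mul"
  unfolding mul_def
  by (rule smooth_on_\<eta>[OF smooth_into_subset[OF smooth_into_mul]]) (auto simp: dom_mul_def)

lemma smooth_comm: "smooth_on dom_comm comm"
  unfolding comm_def
  by (rule smooth_on_\<eta>[OF smooth_into_subset[OF smooth_into_comm]]) (auto simp: dom_comm_def)

lemma dom_0 [simp]: "a \<in> \<Omega> \<Longrightarrow> (a, 0) \<in> dom_mul" "a \<in> \<Omega> \<Longrightarrow> (0, a) \<in> dom_mul"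
    "a \<in> \<Omega> \<Longrightarrow> (a, 0) \<in> dom_comm" "a \<in> \<Omega> \<Longrightarrow> (0, a) \<in> dom_comm"
  using zero_\<Omega> \<xi>_U0[of a] zero_U0 by (auto simp: dom_mul_def dom_comm_def)

lemma mul_0: "a \<in> \<Omega> \<Longrightarrow> mul (a, 0) = P a" "a \<in> \<Omega> \<Longrightarrow> mul (0, a) = P a"
  by (simp_all add: mul_def \<eta>_\<xi>)

lemma comm_0: "comm (a, 0) = 0" "comm (0, a) = 0"
  by (simp_all add: comm_def)

definition mul1 :: "'e \<Rightarrow> 'e \<Rightarrow> 'e" where
  "mul1 \<beta> w = frechet_derivative mul (at (0, \<beta>)) (w, 0)"
definition mul2 :: "'e \<Rightarrow> 'e \<Rightarrow> 'e" where
  "mul2 \<beta> w = frechet_derivative mul (at (\<beta>, 0)) (0, w)"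
definition comm2 :: "'e \<Rightarrow> 'e \<Rightarrow> 'e" where
  "comm2 \<beta> w = frechet_derivative comm (at (\<beta>, 0)) (0, w)"

lemma smooth_mul1: "smooth_on \<Omega> (\<lambda>\<beta>. mul1 \<beta> w)"
  unfolding mul1_def
  by (rule smooth_on_frechet_derivative_param[OF dom_mul_open smooth_mul])
    (auto intro!: smooth_on_Pair smooth_on_const smooth_on_bounded_linear bounded_linear_Pair[OF bounded_linear_zero bounded_linear_ident] bounded_linear_Pair[OF bounded_linear_ident bounded_linear_zero])

lemma smooth_mul2: "smooth_on \<Omega> (\<lambda>\<beta>. mul2 \<beta> w)"
  unfolding mul2_def
  by (rule smooth_on_frechet_derivative_param[OF dom_mul_open smooth_mul])
    (auto intro!: smooth_on_Pair smooth_on_const smooth_on_bounded_linear bounded_linear_Pair[OF bounded_linear_zero bounded_linear_ident] bounded_linear_Pair[OF bounded_linear_ident bounded_linear_zero])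

lemma smooth_comm2: "smooth_on \<Omega> (\<lambda>\<beta>. comm2 \<beta> w)"
  unfolding comm2_def
  by (rule smooth_on_frechet_derivative_param[OF dom_comm_open smooth_comm])
    (auto intro!: smooth_on_Pair smooth_on_const smooth_on_bounded_linear bounded_linear_Pair[OF bounded_linear_zero bounded_linear_ident] bounded_linear_Pair[OF bounded_linear_ident bounded_linear_zero])

section \<open>Differentials of multiplication and commutator\<close>

lemma has_derivative_mul: "z \<in> dom_mul \<Longrightarrow> (mul has_derivative frechet_derivative mul (at z)) (at z)"
  using smooth_on_differentiable[OF dom_mul_open smooth_mul] frechet_derivative_works by blast

lemma has_derivative_comm: "z \<in> dom_comm \<Longrightarrow> (comm has_derivative frechet_derivative comm (at z)) (at z)"
  using smooth_on_differentiable[OF dom_comm_open smooth_comm] frechet_derivative_works by blast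

lemma has_derivative_slice1:
  assumes "(f has_derivative f') (at (a, b))"
  shows "((\<lambda>x. f (x, b)) has_derivative (\<lambda>w. f' (w, 0))) (at a)"
  by (rule has_derivative_compose[where g=f and s=UNIV]) (use assms in \<open>auto intro!: derivative_eq_intros\<close>)

lemma has_derivative_slice2:
  assumes "(f has_derivative f') (at (a, b))"
  shows "((\<lambda>y. f (a, y)) has_derivative (\<lambda>w. f' (0, w))) (at b)"
  by (rule has_derivative_compose[where g=f and s=UNIV]) (use assms in \<open>auto intro!: derivative_eq_intros\<close>)

lemma has_derivative_mul1: "\<beta> \<in> \<Omega> \<Longrightarrow> ((\<lambda>a. mul (a, \<beta>)) has_derivative mul1 \<beta>) (at 0)"
  unfolding mul1_def[abs_def] by (rule has_derivative_slice1[OF has_derivative_mul]) simp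

lemma has_derivative_mul2: "\<beta> \<in> \<Omega> \<Longrightarrow> ((\<lambda>a. mul (\<beta>, a)) has_derivative mul2 \<beta>) (at 0)"
  unfolding mul2_def[abs_def] by (rule has_derivative_slice2[OF has_derivative_mul]) simp

lemma has_derivative_comm2: "\<beta> \<in> \<Omega> \<Longrightarrow> ((\<lambda>a. comm (\<beta>, a)) has_derivative comm2 \<beta>) (at 0)"
  unfolding comm2_def[abs_def] by (rule has_derivative_slice2[OF has_derivative_comm]) simp

lemma P_has_derivative: "(P has_derivative P) F"
  by (rule bounded_linear_imp_has_derivative[OF P_bounded_linear])

lemma derivative_mul_left:
  assumes "\<beta> \<in> \<Omega>"
  shows "frechet_derivative mul (at (\<beta>, 0)) (u, 0) = P u"
proof -
  have 1: "((\<lambda>x. mul (x, 0)) has_derivative (\<lambda>w. frechet_derivative mul (at (\<beta>, 0)) (w, 0))) (at \<beta>)"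
    by (rule has_derivative_slice1[OF has_derivative_mul]) (simp add: assms)
  have "((\<lambda>x. mul (x, 0)) has_derivative P) (at \<beta>)"
    by (rule has_derivative_transform_within_open[OF P_has_derivative \<Omega>_open assms]) (simp add: mul_0)
  from fun_cong[OF has_derivative_unique[OF 1 this], of u] show ?thesis by simp
qed

lemma derivative_mul_right:
  assumes "\<beta> \<in> \<Omega>"
  shows "frechet_derivative mul (at (0, \<beta>)) (0, u) = P u"
proof -
  have 1: "((\<lambda>x. mul (0, x)) has_derivative (\<lambda>w. frechet_derivative mul (at (0, \<beta>)) (0, w))) (at \<beta>)"
    by (rule has_derivative_slice2[OF has_derivative_mul]) (simp add: assms)
  have "((\<lambda>x. mul (0, x)) has_derivative P) (at \<beta>)"
    by (rule has_derivative_transform_within_open[OF P_has_derivative \<Omega>_open assms]) (simp add: mul_0)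
  from fun_cong[OF has_derivative_unique[OF 1 this], of u] show ?thesis by simp
qed

lemma mul1_0: "mul1 0 w = P w"
  unfolding mul1_def by (rule derivative_mul_left) (rule zero_\<Omega>)

text \<open>On the two axes \<open>mul\<close> is just \<open>P\<close>, so to first order the
  multiplication at the neutral element is addition in \<open>V\<close>.\<close>

lemma derivative_mul_0: "frechet_derivative mul (at (0, 0)) (u, w) = P u + P w"
proof -
  have "linear (frechet_derivative mul (at (0, 0)))"
    using has_derivative_linear[OF has_derivative_mul[of "(0, 0)"]] zero_\<Omega> by simp
  from linear_add[OF this, of "(u, 0)" "(0, w)"]
  show ?thesis by (simp add: derivative_mul_left derivative_mul_right zero_\<Omega>)
qed

lemma mul1_linear: "\<beta> \<in> \<Omega> \<Longrightarrow> linear (mul1 \<beta>)"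
  and comm2_linear: "\<beta> \<in> \<Omega> \<Longrightarrow> linear (comm2 \<beta>)"
  using has_derivative_linear has_derivative_mul1 has_derivative_comm2 by blast+

lemma comm2_0: "comm2 0 w = 0"
proof -
  have "((\<lambda>a. comm (0, a)) has_derivative (\<lambda>w. 0)) (at 0)" by (simp add: comm_0)
  from fun_cong[OF has_derivative_unique[OF has_derivative_comm2[OF zero_\<Omega>] this], of w] show ?thesis by simp
qed

text \<open>Differentiate \<open>a + \<beta> = [a, \<beta>] + (\<beta> + a)\<close> with respect to \<open>a\<close> at 0.\<close>

lemma mul1_eq:
  assumes \<beta>: "\<beta> \<in> \<Omega>" "P \<beta> = \<beta>"
  shows "mul1 \<beta> w = mul1 \<beta> (comm2 \<beta> w) + P (mul2 \<beta> w)"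
proof -
  let ?S = "{a \<in> (\<lambda>a. (\<beta>, a)) -` dom_comm. (\<beta>, a) \<in> dom_mul \<and> (a, \<beta>) \<in> dom_mul}"
  have eq: "mul (comm (\<beta>, a), mul (\<beta>, a)) = mul (a, \<beta>)" if "a \<in> ?S" for a
  proof -
    have "\<xi> a + \<xi> \<beta> - \<xi> a - \<xi> \<beta> \<in> U0" "\<xi> \<beta> + \<xi> a \<in> U0" using that by (auto simp: dom_comm_def dom_mul_def)
    then have "\<xi> (comm (\<beta>, a)) = \<xi> a + \<xi> \<beta> - \<xi> a - \<xi> \<beta>" "\<xi> (mul (\<beta>, a)) = \<xi> \<beta> + \<xi> a"
      by (simp_all add: comm_def mul_def \<xi>_\<eta>)
    then have "\<xi> (comm (\<beta>, a)) + \<xi> (mul (\<beta>, a)) = \<xi> a + \<xi> \<beta>"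
      by (metis add.assoc diff_add_cancel)
    then show ?thesis by (simp add: mul_def)
  qed
  have "?S = (\<lambda>a. (\<beta>, a)) -` dom_comm \<inter> ((\<lambda>a. (\<beta>, a)) -` dom_mul \<inter> (\<lambda>a. (a, \<beta>)) -` dom_mul)" by auto
  then have o: "open ?S"
    by (auto intro!: open_Int open_vimage dom_comm_open dom_mul_open continuous_intros)
  have in_S: "0 \<in> ?S" using \<beta> by simp
  have "((\<lambda>a. (comm (\<beta>, a), mul (\<beta>, a))) has_derivative (\<lambda>w. (comm2 \<beta> w, mul2 \<beta> w))) (at 0)"
    by (intro has_derivative_Pair has_derivative_comm2 has_derivative_mul2 \<beta>)
  \<comment> \<open>The inner map has value \<open>(0, P \<beta>)\<close> at 0; the hypothesis
    \<open>P \<beta> = \<beta>\<close> turns this into the base point of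
    \<open>mul1 \<beta>\<close>.\<close>
  moreover have "(mul has_derivative frechet_derivative mul (at (0, \<beta>))) (at (comm (\<beta>, 0), mul (\<beta>, 0)))"
    using has_derivative_mul[of "(0, \<beta>)"] \<beta> by (simp add: comm_0 mul_0)
  ultimately have "((\<lambda>a. mul (comm (\<beta>, a), mul (\<beta>, a))) has_derivative
      (\<lambda>w. frechet_derivative mul (at (0, \<beta>)) (comm2 \<beta> w, mul2 \<beta> w))) (at 0)"
    by (rule has_derivative_compose)
  then have "((\<lambda>a. mul (a, \<beta>)) has_derivative
      (\<lambda>w. frechet_derivative mul (at (0, \<beta>)) (comm2 \<beta> w, mul2 \<beta> w))) (at 0)"
    by (rule has_derivative_transform_within_open[OF _ o in_S]) (rule eq)
  from has_derivative_unique[OF has_derivative_mul1[OF \<beta>(1)] this]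
  have "mul1 \<beta> w = frechet_derivative mul (at (0, \<beta>)) ((comm2 \<beta> w, 0) + (0, mul2 \<beta> w))"
    by simp
  also have "\<dots> = mul1 \<beta> (comm2 \<beta> w) + P (mul2 \<beta> w)"
    using linear_add[OF has_derivative_linear[OF has_derivative_mul[OF dom_0(2)[OF \<beta>(1)]]]]
      derivative_mul_right[OF \<beta>(1)] by (simp only: mul1_def)
  finally show ?thesis .
qed

end

section \<open>Symmetry of second derivatives\<close>

lemma has_real_derivative_along_line:
  fixes F :: "'a::real_normed_vector \<Rightarrow> real"
  assumes "F differentiable (at (x + t *\<^sub>R v))"
  shows "((\<lambda>t. F (x + t *\<^sub>R v)) has_real_derivative frechet_derivative F (at (x + t *\<^sub>R v)) v) (at t)"
proof -
  have "((\<lambda>s. F ((x + t *\<^sub>R v) + s *\<^sub>R v)) has_real_derivative frechet_derivative F (at (x + t *\<^sub>R v)) v) (at 0)"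
    by (rule deriv_along_line[OF assms])
  then have "((\<lambda>s. F (x + (s + t) *\<^sub>R v)) has_real_derivative frechet_derivative F (at (x + t *\<^sub>R v)) v) (at 0)"
    by (simp add: scaleR_add_left add_ac)
  then show ?thesis using DERIV_shift[of "\<lambda>t. F (x + t *\<^sub>R v)" _ 0 t] by simp
qed

text \<open>Two uses of the mean value theorem, first along \<open>u\<close> for the difference of
  \<open>F\<close> at points shifted by \<open>s *\<^sub>R v\<close>, then along \<open>v\<close>
  for the derivative in direction \<open>u\<close>, express the quotient exactly as a value of
  \<open>H\<close> close to \<open>x\<close>.\<close>

lemma second_difference_quotient:
  fixes F :: "'a::euclidean_space \<Rightarrow> real" and u v :: 'a
  assumes S: "open S" "smooth_on S F" "x \<in> S"
  defines "H \<equiv> \<lambda>y. frechet_derivative (\<lambda>y. frechet_derivative F (at y) u) (at y) v"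
  shows "((\<lambda>s. (F (x + s *\<^sub>R u + s *\<^sub>R v) - F (x + s *\<^sub>R u) - F (x + s *\<^sub>R v) + F x) / s\<^sup>2) \<longlongrightarrow> H x)
    (at_right 0)"
proof (rule tendstoI)
  fix e :: real assume "e > 0"
  let ?G = "\<lambda>y. frechet_derivative F (at y) u"
  have G: "smooth_on S ?G" by (rule smooth_on_frechet_derivative[OF S(1,2)])
  have "continuous_on S H" unfolding H_def
    by (intro smooth_on_imp_continuous_on smooth_on_frechet_derivative S G)
  then have "isCont H x" using S by (simp add: continuous_on_eq_continuous_at)
  then obtain r1 where r1: "r1 > 0" "\<And>y. dist y x < r1 \<Longrightarrow> dist (H y) (H x) < e"
    using \<open>e > 0\<close> unfolding continuous_at_eps_delta by (metis dist_commute)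
  obtain r2 where r2: "r2 > 0" "ball x r2 \<subseteq> S" using S open_contains_ball by blast
  \<comment> \<open>With this bound every intermediate point stays within \<open>min r1 r2\<close>
    of \<open>x\<close>; the summand 1 keeps the denominator positive and the estimate
    strict.\<close>
  define d where "d = min r1 r2 / (norm u + norm v + 1)"
  have np: "norm u + norm v + 1 > 0" by (simp add: add_nonneg_pos)
  then have "d > 0" using r1 r2 by (simp add: d_def)
  have near: "dist (x + \<rho> *\<^sub>R u + \<sigma> *\<^sub>R v) x < min r1 r2" if "0 \<le> \<rho>" "\<rho> < d" "0 \<le> \<sigma>" "\<sigma> < d" for \<rho> \<sigma>
  proof -
    have "dist (x + \<rho> *\<^sub>R u + \<sigma> *\<^sub>R v) x = norm (\<rho> *\<^sub>R u + \<sigma> *\<^sub>R v)"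
      by (simp add: dist_norm add.assoc)
    also have "\<dots> \<le> \<rho> * norm u + \<sigma> * norm v"
      using that norm_triangle_ineq[of "\<rho> *\<^sub>R u" "\<sigma> *\<^sub>R v"] by simp
    also have "\<dots> \<le> d * norm u + d * norm v"
      using that by (intro add_mono mult_right_mono) auto
    also have "\<dots> < d * (norm u + norm v + 1)" using \<open>d > 0\<close> by (simp add: algebra_simps)
    also have "\<dots> = min r1 r2" using np by (simp add: d_def)
    finally show ?thesis .
  qed
  then have in_S: "x + \<rho> *\<^sub>R u + \<sigma> *\<^sub>R v \<in> S" if "0 \<le> \<rho>" "\<rho> < d" "0 \<le> \<sigma>" "\<sigma> < d" for \<rho> \<sigma>
    using that r2(2) by (force simp: dist_commute)
  have "dist ((F (x + s *\<^sub>R u + s *\<^sub>R v) - F (x + s *\<^sub>R u) - F (x + s *\<^sub>R v) + F x) / s\<^sup>2) (H x) < e"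
    if s: "0 < s" "s < d" for s
  proof -
    have "((\<lambda>\<rho>. F ((x + s *\<^sub>R v) + \<rho> *\<^sub>R u) - F (x + \<rho> *\<^sub>R u)) has_real_derivative
       ?G ((x + s *\<^sub>R v) + \<rho> *\<^sub>R u) - ?G (x + \<rho> *\<^sub>R u)) (at \<rho>)" if \<rho>: "0 \<le> \<rho>" "\<rho> \<le> s" for \<rho>
    proof (intro DERIV_diff has_real_derivative_along_line smooth_on_differentiable[OF S(1,2)])
      show "x + s *\<^sub>R v + \<rho> *\<^sub>R u \<in> S" using in_S[of \<rho> s] \<rho> s by (simp add: add_ac)
      show "x + \<rho> *\<^sub>R u \<in> S" using in_S[of \<rho> 0] \<rho> s \<open>d > 0\<close> by simp
    qed
    from MVT2[OF s(1) this] obtain \<rho> where \<rho>: "0 < \<rho>" "\<rho> < s" and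
      1: "F (x + s *\<^sub>R v + s *\<^sub>R u) - F (x + s *\<^sub>R u) - (F (x + s *\<^sub>R v) - F x)
        = s * (?G (x + s *\<^sub>R v + \<rho> *\<^sub>R u) - ?G (x + \<rho> *\<^sub>R u))" by auto
    have "((\<lambda>\<sigma>. ?G ((x + \<rho> *\<^sub>R u) + \<sigma> *\<^sub>R v)) has_real_derivative H ((x + \<rho> *\<^sub>R u) + \<sigma> *\<^sub>R v)) (at \<sigma>)"
      if \<sigma>: "0 \<le> \<sigma>" "\<sigma> \<le> s" for \<sigma>
      unfolding H_def
      by (intro has_real_derivative_along_line smooth_on_differentiable[OF S(1) G] in_S) (use \<rho> \<sigma> s in auto)
    from MVT2[OF s(1) this] obtain \<sigma> where \<sigma>: "0 < \<sigma>" "\<sigma> < s" and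
      2: "?G (x + \<rho> *\<^sub>R u + s *\<^sub>R v) - ?G (x + \<rho> *\<^sub>R u) = s * H (x + \<rho> *\<^sub>R u + \<sigma> *\<^sub>R v)" by auto
    have "F (x + s *\<^sub>R u + s *\<^sub>R v) - F (x + s *\<^sub>R u) - F (x + s *\<^sub>R v) + F x
        = s * (s * H (x + \<rho> *\<^sub>R u + \<sigma> *\<^sub>R v))"
      unfolding 2[symmetric] using 1 by (simp add: add_ac)
    then have "(F (x + s *\<^sub>R u + s *\<^sub>R v) - F (x + s *\<^sub>R u) - F (x + s *\<^sub>R v) + F x) / s\<^sup>2
        = H (x + \<rho> *\<^sub>R u + \<sigma> *\<^sub>R v)"
      using s by (simp add: power2_eq_square)
    then show ?thesis using r1(2) near[of \<rho> \<sigma>] \<rho> \<sigma> s by simp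
  qed
  then show "\<forall>\<^sub>F s in at_right 0. dist ((F (x + s *\<^sub>R u + s *\<^sub>R v) - F (x + s *\<^sub>R u) - F (x + s *\<^sub>R v) + F x) / s\<^sup>2) (H x) < e"
    unfolding eventually_at_right_field using \<open>d > 0\<close> by (intro exI[of _ d]) auto
qed

text \<open>The second difference is symmetric in \<open>u\<close> and \<open>v\<close>, so both
  second derivatives are limits of the same quotient.\<close>

lemma smooth_on_second_derivative_symmetric:
  fixes F :: "'a::euclidean_space \<Rightarrow> real"
  assumes "open S" "smooth_on S F" "x \<in> S"
  shows "frechet_derivative (\<lambda>y. frechet_derivative F (at y) u) (at x) v
       = frechet_derivative (\<lambda>y. frechet_derivative F (at y) v) (at x) u"
proof (rule tendsto_unique)
  show "((\<lambda>s. (F (x + s *\<^sub>R u + s *\<^sub>R v) - F (x + s *\<^sub>R u) - F (x + s *\<^sub>R v) + F x) / s\<^sup>2)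
    \<longlongrightarrow> frechet_derivative (\<lambda>y. frechet_derivative F (at y) u) (at x) v) (at_right 0)"
    by (rule second_difference_quotient[OF assms])
  show "((\<lambda>s. (F (x + s *\<^sub>R u + s *\<^sub>R v) - F (x + s *\<^sub>R u) - F (x + s *\<^sub>R v) + F x) / s\<^sup>2)
    \<longlongrightarrow> frechet_derivative (\<lambda>y. frechet_derivative F (at y) v) (at x) u) (at_right 0)"
    using second_difference_quotient[OF assms, of v u] by (simp add: algebra_simps)
qed simp

section \<open>Second-order behavior of the multiplication\<close>

context lie_group_chart
begin

lemma P_inner_bounded_linear: "bounded_linear (\<lambda>y. l \<bullet> P y)"
  by (rule bounded_linear_compose[OF bounded_linear_inner_right P_bounded_linear])

lemma has_derivative_P_inner:
  "(f has_derivative f') F \<Longrightarrow> ((\<lambda>x. l \<bullet> P (f x)) has_derivative (\<lambda>v. l \<bullet> P (f' v))) F"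
  by (rule bounded_linear.has_derivative[OF P_inner_bounded_linear])

text \<open>Product rule: \<open>comm2 0 w = 0\<close> eliminates the term in which
  \<open>mul1\<close> is differentiated, and in the other term \<open>mul1 0\<close> is
  \<open>P\<close>.\<close>

lemma derivative_mul1_comm2:
  assumes c: "((\<lambda>\<beta>. comm2 \<beta> w) has_derivative c') (at 0)"
  shows "((\<lambda>\<beta>. mul1 \<beta> (comm2 \<beta> w)) has_derivative (\<lambda>v. P (c' v))) (at 0)"
proof -
  let ?H = "\<lambda>z. frechet_derivative mul (at (0, fst z)) (snd z, 0)"
  have o: "open (\<Omega> \<times> (UNIV :: 'e set))" by (intro open_Times \<Omega>_open open_UNIV)
  have "smooth_on (\<Omega> \<times> (UNIV :: 'e set)) ?H"
    by (rule smooth_on_frechet_derivative_param[OF dom_mul_open smooth_mul])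
      (auto intro!: smooth_on_bounded_linear bounded_linear_Pair bounded_linear_zero
        bounded_linear_fst bounded_linear_snd)
  then have "?H differentiable (at (0, 0))"
    by (rule smooth_on_differentiable[OF o]) (simp add: zero_\<Omega>)
  then obtain H' where H': "(?H has_derivative H') (at (0, 0))" by (auto simp: differentiable_def)
  \<comment> \<open>As \<open>mul1 0\<close> is \<open>P\<close> and \<open>mul1 \<beta> 0\<close>
    vanishes, the two partial derivatives of \<open>?H\<close> at \<open>(0, 0)\<close> are
    \<open>P\<close> in the direction slot and 0 in the base point slot.\<close>
  have m1: "mul1 \<beta> u = ?H (\<beta>, u)" for \<beta> u by (simp add: mul1_def)
  have "((\<lambda>u. mul1 0 u) has_derivative (\<lambda>u. H' (0, u))) (at 0)"
    unfolding m1 by (rule has_derivative_slice2[OF H'])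
  moreover have "((\<lambda>u. mul1 0 u) has_derivative P) (at 0)"
    using P_has_derivative by (simp add: mul1_0)
  ultimately have H2: "H' (0, u) = P u" for u by (metis has_derivative_unique)
  have "((\<lambda>\<beta>. mul1 \<beta> 0) has_derivative (\<lambda>u. H' (u, 0))) (at 0)"
    unfolding m1 by (rule has_derivative_slice1[OF H'])
  moreover have "((\<lambda>\<beta>. mul1 \<beta> 0) has_derivative (\<lambda>u. 0)) (at 0)"
    by (rule has_derivative_transform_within_open[OF has_derivative_const \<Omega>_open zero_\<Omega>])
      (simp add: linear_0[OF mul1_linear])
  ultimately have H1: "H' (u, 0) = 0" for u by (metis has_derivative_unique)
  have "linear H'" using H' has_derivative_linear by blast
  from linear_add[OF this, of "(_, 0)" "(0, _)"] have H: "H' (a, u) = P u" for a u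
    using H1 H2 by (metis add.left_neutral add_Pair add.right_neutral)
  have "((\<lambda>\<beta>. (\<beta>, comm2 \<beta> w)) has_derivative (\<lambda>v. (v, c' v))) (at 0)"
    by (intro has_derivative_Pair has_derivative_ident c)
  then have "((\<lambda>\<beta>. ?H (\<beta>, comm2 \<beta> w)) has_derivative (\<lambda>v. H' (v, c' v))) (at 0)"
    by (rule has_derivative_compose) (use H' comm2_0 in simp)
  then show ?thesis by (simp add: m1 H)
qed

text \<open>The antisymmetric part of the second-order term of the multiplication is the Lie bracket, so this
  says that \<open>l\<close> vanishes on brackets.\<close>

lemma mixed_derivative_symmetric:
  assumes N: "open N" "0 \<in> N" and l: "\<And>\<beta> w. \<beta> \<in> N \<Longrightarrow> l \<bullet> P (comm2 \<beta> w) = 0"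
    and v: "v \<in> V"
  shows "frechet_derivative (\<lambda>\<beta>. l \<bullet> P (mul2 \<beta> w)) (at 0) v
       = frechet_derivative (\<lambda>\<beta>. l \<bullet> P (mul2 \<beta> v)) (at 0) w"
proof -
  let ?F = "\<lambda>z. l \<bullet> P (mul z)"
  have F: "smooth_on dom_mul ?F"
    by (rule smooth_on_linear_compose[OF P_inner_bounded_linear smooth_mul])
  have F': "frechet_derivative ?F (at z) u = l \<bullet> P (frechet_derivative mul (at z) u)" if "z \<in> dom_mul" for z u
    using frechet_derivative_at[OF has_derivative_P_inner[OF has_derivative_mul[OF that]]] by metis
  have z0: "(0, 0) \<in> dom_mul" using zero_\<Omega> by simp
  have D: "((\<lambda>z. frechet_derivative ?F (at z) u) has_derivative
      frechet_derivative (\<lambda>z. frechet_derivative ?F (at z) u) (at (0, 0))) (at (0, 0))" for u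
    using smooth_on_differentiable[OF dom_mul_open smooth_on_frechet_derivative[OF dom_mul_open F] z0]
      frechet_derivative_works by blast
  have "((\<lambda>\<beta>. l \<bullet> P (mul1 \<beta> w)) has_derivative
     (\<lambda>u. frechet_derivative (\<lambda>z. frechet_derivative ?F (at z) (w, 0)) (at (0, 0)) (0, u))) (at 0)"
    by (rule has_derivative_transform_within_open[OF has_derivative_slice2[OF D] \<Omega>_open zero_\<Omega>])
      (simp add: F' mul1_def)
  then have d1: "frechet_derivative (\<lambda>\<beta>. l \<bullet> P (mul1 \<beta> w)) (at 0) v
     = frechet_derivative (\<lambda>z. frechet_derivative ?F (at z) (w, 0)) (at (0, 0)) (0, v)"
    by (metis frechet_derivative_at)
  have "((\<lambda>\<beta>. l \<bullet> P (mul2 \<beta> v)) has_derivative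
     (\<lambda>u. frechet_derivative (\<lambda>z. frechet_derivative ?F (at z) (0, v)) (at (0, 0)) (u, 0))) (at 0)"
    by (rule has_derivative_transform_within_open[OF has_derivative_slice1[OF D] \<Omega>_open zero_\<Omega>])
      (simp add: F' mul2_def)
  then have d2: "frechet_derivative (\<lambda>\<beta>. l \<bullet> P (mul2 \<beta> v)) (at 0) w
     = frechet_derivative (\<lambda>z. frechet_derivative ?F (at z) (0, v)) (at (0, 0)) (w, 0)"
    by (metis frechet_derivative_at)
  \<comment> \<open>Both sides are the mixed second derivative of \<open>?F\<close> in the
    directions \<open>(w, 0)\<close> and \<open>(0, v)\<close>, taken in the two possible
    orders.\<close>
  have sym: "frechet_derivative (\<lambda>\<beta>. l \<bullet> P (mul1 \<beta> w)) (at 0) v = frechet_derivative (\<lambda>\<beta>. l \<bullet> P (mul2 \<beta> v)) (at 0) w"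
    unfolding d1 d2 by (rule smooth_on_second_derivative_symmetric[OF dom_mul_open F z0])

  obtain c' where c': "((\<lambda>\<beta>. comm2 \<beta> w) has_derivative c') (at 0)"
    using smooth_on_differentiable[OF \<Omega>_open smooth_comm2 zero_\<Omega>] by (auto simp: differentiable_def)
  have "((\<lambda>\<beta>. l \<bullet> P (comm2 \<beta> w)) has_derivative (\<lambda>u. l \<bullet> P (c' u))) (at 0)"
    by (rule has_derivative_P_inner[OF c'])
  moreover have "((\<lambda>\<beta>. l \<bullet> P (comm2 \<beta> w)) has_derivative (\<lambda>u. 0)) (at 0)"
    by (rule has_derivative_transform_within_open[OF has_derivative_const N]) (simp add: l)
  ultimately have "l \<bullet> P (c' u) = 0" for u by (metis has_derivative_unique)
  \<comment> \<open>Since \<open>l\<close> kills \<open>comm2\<close> near 0, it kills the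
    derivative of \<open>comm2\<close> at 0, and hence that of the first summand in
    \<open>mul1_eq\<close>. So \<open>mul1\<close> and \<open>mul2\<close> cannot be told apart
    through \<open>l\<close> to this order.\<close>
  then have E: "((\<lambda>\<beta>. l \<bullet> P (mul1 \<beta> (comm2 \<beta> w))) has_derivative (\<lambda>u. 0)) (at 0)"
    using has_derivative_P_inner[OF derivative_mul1_comm2[OF c'], of l] by simp
  have diff: "(\<lambda>\<beta>. l \<bullet> P (mul1 \<beta> w)) differentiable (at 0)" "(\<lambda>\<beta>. l \<bullet> P (mul2 \<beta> w)) differentiable (at 0)"
    "(\<lambda>\<beta>. l \<bullet> P (mul1 \<beta> (comm2 \<beta> w))) differentiable (at 0)"
    using smooth_on_differentiable[OF \<Omega>_open smooth_on_linear_compose[OF P_inner_bounded_linear] zero_\<Omega>]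
      smooth_mul1 smooth_mul2 E by (auto simp: differentiable_def)
  \<comment> \<open>\<open>mul1_eq\<close> is available only at points fixed by \<open>P\<close>, so
    the two sides are compared along the line through \<open>v\<close>, which lies in
    \<open>V\<close>.\<close>
  let ?T = "(\<lambda>s. s *\<^sub>R v) -` \<Omega>"
  have T: "open ?T" "0 \<in> ?T"
    using zero_\<Omega> by (auto intro!: open_vimage \<Omega>_open continuous_intros)
  have eq: "l \<bullet> P (mul1 (s *\<^sub>R v) (comm2 (s *\<^sub>R v) w)) + l \<bullet> P (mul2 (s *\<^sub>R v) w) = l \<bullet> P (mul1 (s *\<^sub>R v) w)"
    if "s \<in> ?T" for s
  proof -
    have "P (s *\<^sub>R v) = s *\<^sub>R v" using v V_subspace by (simp add: P_id subspace_scale)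
    then show ?thesis
      using mul1_eq[of "s *\<^sub>R v" w] that linear_add[OF P_linear] by (simp add: inner_add_right)
  qed
  have l1: "((\<lambda>s. l \<bullet> P (mul1 (s *\<^sub>R v) w)) has_real_derivative frechet_derivative (\<lambda>\<beta>. l \<bullet> P (mul1 \<beta> w)) (at 0) v) (at 0)"
    using deriv_along_line[OF diff(1), of v] by simp
  have "((\<lambda>s. l \<bullet> P (mul1 (s *\<^sub>R v) (comm2 (s *\<^sub>R v) w)) + l \<bullet> P (mul2 (s *\<^sub>R v) w)) has_real_derivative
     frechet_derivative (\<lambda>\<beta>. l \<bullet> P (mul1 \<beta> (comm2 \<beta> w))) (at 0) v + frechet_derivative (\<lambda>\<beta>. l \<bullet> P (mul2 \<beta> w)) (at 0) v) (at 0)"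
    using DERIV_add[OF deriv_along_line[OF diff(3), of v] deriv_along_line[OF diff(2), of v]] by simp
  then have l2: "((\<lambda>s. l \<bullet> P (mul1 (s *\<^sub>R v) w)) has_real_derivative
     frechet_derivative (\<lambda>\<beta>. l \<bullet> P (mul1 \<beta> (comm2 \<beta> w))) (at 0) v + frechet_derivative (\<lambda>\<beta>. l \<bullet> P (mul2 \<beta> w)) (at 0) v) (at 0)"
    by (rule has_field_derivative_transform_within_open[OF _ T]) (rule eq)
  have "frechet_derivative (\<lambda>\<beta>. l \<bullet> P (mul1 \<beta> (comm2 \<beta> w))) (at 0) v = 0"
    using frechet_derivative_at[OF E] by metis
  then have "frechet_derivative (\<lambda>\<beta>. l \<bullet> P (mul2 \<beta> w)) (at 0) v = frechet_derivative (\<lambda>\<beta>. l \<bullet> P (mul1 \<beta> w)) (at 0) v"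
    using DERIV_unique[OF l1 l2] by simp
  then show ?thesis using sym by simp
qed

end

section \<open>The Lie algebra\<close>

context lie_group_chart
begin

lemma lie_algebra_smooth: "X \<in> lie_algebra A \<Longrightarrow> smooth_fun A f \<Longrightarrow> smooth_fun A (X f)"
  by (simp add: lie_algebra_def smooth_vector_fields_def)

text \<open>\<open>v\<close> is the velocity, in coordinates, of a curve that represents
  \<open>X\<close> at 0. Only a coordinate expression \<open>F\<close> valid near 0 and
  differentiable at 0 is asked for, so that the formula applies to \<open>f\<close> as well as to
  derived functions such as \<open>Y f\<close>.\<close>

lemma lie_algebra_velocity:
  assumes "X \<in> lie_algebra A"
  obtains v where "v \<in> V"
    "\<And>f F N. smooth_fun A f \<Longrightarrow> F differentiable (at 0) \<Longrightarrow> open N \<Longrightarrow> 0 \<in> N \<Longrightarrow>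
      (\<And>x. x \<in> N \<Longrightarrow> x \<in> U0 \<and> f x = F (\<eta> x)) \<Longrightarrow> X f 0 = frechet_derivative F (at 0) v"
proof -
  have "(\<lambda>f. X f 0) \<in> tangent_space A 0"
    using assms by (simp add: lie_algebra_def smooth_vector_fields_def)
  then obtain c where c: "smooth_curve_at A 0 c"
    and X: "(\<lambda>f. X f 0) = (\<lambda>f. if smooth_fun A f then deriv (f \<circ> c) 0 else 0)"
    unfolding tangent_space_def by blast
  obtain \<epsilon> where e: "\<epsilon> > 0" "smooth_into A {-\<epsilon><..<\<epsilon>} c" and c0: "c 0 = 0"
    using c unfolding smooth_curve_at_iff by blast
  let ?I = "{t \<in> {-\<epsilon><..<\<epsilon>}. c t \<in> U0}"
  have I: "open ?I" by (rule open_smooth_domain[OF _ e(2) U0_open]) simp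
  have 0: "0 \<in> ?I" using e c0 zero_U0 by simp
  have "smooth_on ?I (\<lambda>t. \<eta> (c t))"
    by (rule smooth_on_\<eta>[OF smooth_into_subset[OF e(2)]]) auto
  from smooth_on_differentiable[OF I this 0]
  obtain D where D: "((\<lambda>t. \<eta> (c t)) has_derivative D) (at 0)" by (auto simp: differentiable_def)
  \<comment> \<open>The coordinate curve lies in \<open>V\<close>, where \<open>P\<close> is the
    identity; by uniqueness its velocity is fixed by \<open>P\<close>, hence in
    \<open>V\<close>.\<close>
  have "((\<lambda>t. P (\<eta> (c t))) has_derivative (\<lambda>s. P (D s))) (at 0)"
    by (rule bounded_linear.has_derivative[OF P_bounded_linear D])
  then have "((\<lambda>t. \<eta> (c t)) has_derivative (\<lambda>s. P (D s))) (at 0)"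
    by (rule has_derivative_transform_within_open[OF _ I 0]) (simp add: P_\<eta>)
  then have PD: "D s = P (D s)" for s using has_derivative_unique[OF D] by metis
  show thesis
  proof (rule that)
    show "D 1 \<in> V" using PD P_V by metis
    fix f F N
    assume f: "smooth_fun A f" and F: "F differentiable (at 0)" and N: "open N" "0 \<in> N"
      and fF: "\<And>x. x \<in> N \<Longrightarrow> x \<in> U0 \<and> f x = F (\<eta> x)"
    have J: "open {t \<in> {-\<epsilon><..<\<epsilon>}. c t \<in> N}" by (rule open_smooth_domain[OF _ e(2) N(1)]) simp
    have "(F has_derivative frechet_derivative F (at 0)) (at (\<eta> (c 0)))"
      using F c0 by (simp add: frechet_derivative_works)
    from has_derivative_compose[OF D this]
    have der: "((\<lambda>t. f (c t)) has_derivative (\<lambda>s. frechet_derivative F (at 0) (D s))) (at 0)"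
      by (rule has_derivative_transform_within_open[OF _ J]) (use e c0 N fF in auto)
    have "frechet_derivative F (at 0) (D s) = frechet_derivative F (at 0) (D 1) * s" for s
    proof -
      have "D s = s *\<^sub>R D 1" using linear_cmul[OF has_derivative_linear[OF D], of s 1] by simp
      then show ?thesis using linear_cmul[OF linear_frechet_derivative[OF F]] by simp
    qed
    then have "(\<lambda>s. frechet_derivative F (at 0) (D s)) = (*) (frechet_derivative F (at 0) (D 1))" by (rule ext)
    then have "((\<lambda>t. f (c t)) has_real_derivative frechet_derivative F (at 0) (D 1)) (at 0)"
      unfolding has_field_derivative_def using der by metis
    then have "deriv (f \<circ> c) 0 = frechet_derivative F (at 0) (D 1)"
      by (simp add: DERIV_imp_deriv o_def)
    then show "X f 0 = frechet_derivative F (at 0) (D 1)" using fun_cong[OF X, of f] f by simp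
  qed
qed

text \<open>By left invariance, \<open>Y f p\<close> is the value at 0 of \<open>Y\<close> on the
  translate of \<open>f\<close> by \<open>p\<close>, so in coordinates \<open>Y f\<close> is
  \<open>l \<bullet> P (mul2 \<beta> w)\<close> near 0. Applying \<open>X\<close> at 0
  differentiates this along \<open>v\<close>, and the bracket becomes the difference of the two
  sides of \<open>mixed_derivative_symmetric\<close>.\<close>

lemma lie_bracket_functional_0:
  assumes X: "X \<in> lie_algebra A" and Y: "Y \<in> lie_algebra A"
    and N: "open N" "0 \<in> N" and l: "\<And>\<beta> w. \<beta> \<in> N \<Longrightarrow> l \<bullet> P (comm2 \<beta> w) = 0"
    and f: "smooth_fun A f" and N0: "open N0" "0 \<in> N0" and fl: "\<And>x. x \<in> N0 \<Longrightarrow> x \<in> U0 \<and> f x = l \<bullet> \<eta> x"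
  shows "lie_bracket X Y f 0 = 0"
proof -
  have first: "Y f p = l \<bullet> P (mul2 (\<eta> p) w)"
    if Y: "Y \<in> lie_algebra A" and p: "p \<in> N0"
      and w: "\<And>f F N. smooth_fun A f \<Longrightarrow> F differentiable (at 0) \<Longrightarrow> open N \<Longrightarrow> 0 \<in> N \<Longrightarrow>
        (\<And>x. x \<in> N \<Longrightarrow> x \<in> U0 \<and> f x = F (\<eta> x)) \<Longrightarrow> Y f 0 = frechet_derivative F (at 0) w"
    for Y p w
  proof -
    have p\<Omega>: "\<eta> p \<in> \<Omega>" using fl[OF p] \<eta>_\<Omega> by blast
    let ?F = "\<lambda>a. l \<bullet> P (mul (\<eta> p, a))"
    have F: "(?F has_derivative (\<lambda>a. l \<bullet> P (mul2 (\<eta> p) a))) (at 0)"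
      by (rule has_derivative_P_inner[OF has_derivative_mul2[OF p\<Omega>]])
    let ?N = "U0 \<inter> (\<lambda>x. p + x) -` N0"
    have "Y (\<lambda>x. f (p + x)) 0 = frechet_derivative ?F (at 0) w"
    proof (rule w)
      show "smooth_fun A (\<lambda>x. f (p + x))" by (rule smooth_fun_translate[OF G f])
      show "?F differentiable (at 0)" using F by (auto simp: differentiable_def)
      show "open ?N" by (intro open_Int U0_open open_vimage N0 continuous_intros)
      show "0 \<in> ?N" using zero_U0 p by simp
      fix x assume x: "x \<in> ?N"
      then have "p + x \<in> N0" by simp
      from fl[OF this] have "p + x \<in> U0" "f (p + x) = l \<bullet> \<eta> (p + x)" by auto
      moreover have "mul (\<eta> p, \<eta> x) = \<eta> (p + x)"
        using x fl[OF p] by (simp add: mul_def \<xi>_\<eta>)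
      ultimately show "x \<in> U0 \<and> f (p + x) = ?F (\<eta> x)" using x by (simp add: P_\<eta>)
    qed
    also have "\<dots> = l \<bullet> P (mul2 (\<eta> p) w)" using frechet_derivative_at[OF F] by metis
    also have "Y (\<lambda>x. f (p + x)) 0 = Y f p"
      using Y unfolding lie_algebra_def by (simp add: fun_eq_iff)
    finally show ?thesis .
  qed
  have diff: "(\<lambda>\<beta>. l \<bullet> P (mul2 \<beta> w)) differentiable (at 0)" for w
    by (rule smooth_on_differentiable[OF \<Omega>_open smooth_on_linear_compose[OF P_inner_bounded_linear smooth_mul2] zero_\<Omega>])
  obtain v where v: "v \<in> V" "\<And>f F N. smooth_fun A f \<Longrightarrow> F differentiable (at 0) \<Longrightarrow> open N \<Longrightarrow> 0 \<in> N \<Longrightarrow>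
        (\<And>x. x \<in> N \<Longrightarrow> x \<in> U0 \<and> f x = F (\<eta> x)) \<Longrightarrow> X f 0 = frechet_derivative F (at 0) v"
    by (rule lie_algebra_velocity[OF X]) blast
  obtain w where w: "w \<in> V" "\<And>f F N. smooth_fun A f \<Longrightarrow> F differentiable (at 0) \<Longrightarrow> open N \<Longrightarrow> 0 \<in> N \<Longrightarrow>
        (\<And>x. x \<in> N \<Longrightarrow> x \<in> U0 \<and> f x = F (\<eta> x)) \<Longrightarrow> Y f 0 = frechet_derivative F (at 0) w"
    by (rule lie_algebra_velocity[OF Y]) blast
  have fY: "Y f x = l \<bullet> P (mul2 (\<eta> x) w)" if "x \<in> N0" for x
    by (rule first[OF Y that], rule w(2))
  have fX: "X f x = l \<bullet> P (mul2 (\<eta> x) v)" if "x \<in> N0" for x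
    by (rule first[OF X that], rule v(2))
  have "X (Y f) 0 = frechet_derivative (\<lambda>\<beta>. l \<bullet> P (mul2 \<beta> w)) (at 0) v"
    by (rule v(2)[OF lie_algebra_smooth[OF Y f] diff N0]) (simp add: fY fl)
  moreover have "Y (X f) 0 = frechet_derivative (\<lambda>\<beta>. l \<bullet> P (mul2 \<beta> v)) (at 0) w"
    by (rule w(2)[OF lie_algebra_smooth[OF X f] diff N0]) (simp add: fX fl)
  ultimately show ?thesis
    using mixed_derivative_symmetric[OF N l v(1), of w] by (simp add: lie_bracket_def)
qed

text \<open>Vector fields act on globally defined functions, so the coordinate function
  \<open>l \<bullet> \<eta> x\<close> has to be cut off by a bump and extended by 0.\<close>

lemma smooth_fun_with_differential:
  obtains f N where "smooth_fun A f" "open N" "0 \<in> N" "\<And>x. x \<in> N \<Longrightarrow> x \<in> U0 \<and> f x = l \<bullet> \<eta> x"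
proof -
  obtain r where r: "r > 0" "cball 0 r \<subseteq> \<Omega>"
    using \<Omega>_open zero_\<Omega> open_contains_cball by blast
  obtain b :: "'e \<Rightarrow> real" and s where b: "smooth_on UNIV b" "s > 0"
      "\<And>x. norm x < s \<Longrightarrow> b x = 1" "\<And>x. norm x \<ge> r \<Longrightarrow> b x = 0"
    using smooth_bump[OF r(1)] by blast
  define f where "f x = (if x \<in> U0 then b (\<eta> x) * (l \<bullet> \<eta> x) else 0)" for x
  let ?K = "\<xi> ` cball 0 r"
  have "compact ?K"
    by (rule compact_continuous_image[OF continuous_on_subset[OF continuous_on_\<xi> r(2)]]) simp
  \<comment> \<open>The Hausdorff property enters here: \<open>U0\<close> and the complement of
    \<open>?K\<close> form an open cover, and the extension is smooth on each of the two.\<close>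
  then have K: "closed ?K" by (rule compact_imp_closed)
  have KU: "?K \<subseteq> U0" by (rule image_subsetI, rule \<xi>_U0) (use r(2) in auto)
  have f0: "f x = 0" if "x \<notin> ?K" for x
  proof (cases "x \<in> U0")
    case True
    then have "\<eta> x \<notin> cball 0 r" using that \<xi>_\<eta> by (metis imageI)
    then show ?thesis using b(4) by (simp add: f_def)
  qed (simp add: f_def)
  have "smooth_fun A f"
  proof (rule smooth_funI[OF G], rule smooth_on_local)
    fix U \<phi> a assume U: "(U, \<phi>) \<in> A" and a: "a \<in> \<phi> ` U"
    let ?S = "\<phi> ` U" and ?h = "inv_into U \<phi>"
    have h: "smooth_into A ?S ?h" by (rule smooth_into_chart_inv[OF G U])
    show "\<exists>T. open T \<and> a \<in> T \<and> smooth_on (?S \<inter> T) (\<lambda>a. f (?h a))"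
    proof (cases "?h a \<in> U0")
      case True
      obtain T where T: "open T" "?S \<inter> T = {x\<in>?S. ?h x \<in> U0}"
        using smooth_intoD(1)[OF h] U0_open by (rule continuous_on_open_nbhd)
      have \<eta>h: "smooth_on (?S \<inter> T) (\<lambda>a. \<eta> (?h a))"
        by (rule smooth_on_\<eta>[OF smooth_into_subset[OF h]]) (use T in auto)
      have "smooth_on (?S \<inter> T) (\<lambda>a. b (\<eta> (?h a)) * (l \<bullet> \<eta> (?h a)))"
        by (intro smooth_on_bilinear[OF bounded_bilinear_mult] smooth_on_compose[OF \<eta>h b(1)]
            smooth_on_linear_compose[OF bounded_linear_inner_right \<eta>h]) simp
      then have "smooth_on (?S \<inter> T) (\<lambda>a. f (?h a))"
        by (rule smooth_on_cong) (use T(2) in \<open>auto simp: f_def\<close>)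
      moreover have "a \<in> T" using T(2) True a by blast
      ultimately show ?thesis using T(1) by blast
    next
      case False
      obtain T where T: "open T" "?S \<inter> T = {x\<in>?S. ?h x \<in> - ?K}"
        using smooth_intoD(1)[OF h] open_Compl[OF K] by (rule continuous_on_open_nbhd)
      have "smooth_on (?S \<inter> T) (\<lambda>a. f (?h a))"
        by (rule smooth_on_cong[OF smooth_on_const[of _ 0]]) (use T(2) f0 in auto)
      moreover have "?h a \<notin> ?K" using False KU by auto
      then have "a \<in> T" using IntD2[of a ?S T] T(2) a by simp
      ultimately show ?thesis using T(1) by (intro exI[of _ T]) simp
    qed
  qed
  moreover have "open (\<eta> -` ball 0 s \<inter> U0)"
    using continuous_on_open_vimage[OF U0_open] continuous_on_\<eta> by (metis open_ball)
  moreover have "0 \<in> \<eta> -` ball 0 s \<inter> U0" using zero_U0 b(2) by simp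
  moreover have "x \<in> U0 \<and> f x = l \<bullet> \<eta> x" if "x \<in> \<eta> -` ball 0 s \<inter> U0" for x
    using that b(3) by (simp add: f_def)
  ultimately show thesis using that by blast
qed

lemma line_in_\<Omega>: obtains \<epsilon> where "\<epsilon> > 0" "\<And>t. t \<in> {-\<epsilon><..<\<epsilon>} \<Longrightarrow> t *\<^sub>R v \<in> \<Omega>"
proof -
  have "open ((\<lambda>t::real. t *\<^sub>R v) -` \<Omega>)" by (intro open_vimage \<Omega>_open continuous_intros)
  moreover have "0 \<in> (\<lambda>t::real. t *\<^sub>R v) -` \<Omega>" using zero_\<Omega> by simp
  ultimately obtain \<epsilon> where "\<epsilon> > 0" "ball 0 \<epsilon> \<subseteq> (\<lambda>t::real. t *\<^sub>R v) -` \<Omega>"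
    using open_contains_ball by blast
  then show thesis using that[of \<epsilon>] by (auto simp: subset_iff dist_real_def abs_less_iff)
qed

text \<open>Realizes any given velocity at 0. Right multiplication by the coordinate curve with
  velocity \<open>v\<close> provides a curve through each \<open>p\<close>, and it commutes with
  left translations.\<close>

lemma left_invariant_field:
  "(\<lambda>f p. if smooth_fun A f then deriv (\<lambda>t. f (p + \<xi> (t *\<^sub>R v))) 0 else 0) \<in> lie_algebra A"
  (is "?X \<in> _")
proof -
  obtain \<epsilon> where e: "\<epsilon> > 0" "\<And>t. t \<in> {-\<epsilon><..<\<epsilon>} \<Longrightarrow> t *\<^sub>R v \<in> \<Omega>" by (rule line_in_\<Omega>) blast
  have tan: "(\<lambda>f. ?X f p) \<in> tangent_space A p" for p
  proof -
    have "smooth_into A {-\<epsilon><..<\<epsilon>} (\<lambda>t. p + \<xi> (t *\<^sub>R v))"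
      by (intro smooth_into_add[OF G] smooth_into_const \<xi>_smooth smooth_on_bounded_linear
          bounded_linear_scaleR_left e(2))
    then have "smooth_curve_at A p (\<lambda>t. p + \<xi> (t *\<^sub>R v))"
      unfolding smooth_curve_at_iff using e(1) by auto
    then show ?thesis unfolding tangent_space_def
      by (auto simp: o_def intro!: exI[of _ "\<lambda>t. p + \<xi> (t *\<^sub>R v)"])
  qed
  have smo: "smooth_fun A (?X f)" if f: "smooth_fun A f" for f
  proof (rule smooth_funI[OF G])
    fix U \<phi> assume U: "(U, \<phi>) \<in> A"
    let ?S = "\<phi> ` U \<times> {-\<epsilon><..<\<epsilon>}"
    have "smooth_into A ?S (\<lambda>z. inv_into U \<phi> (fst z))"
      by (rule smooth_into_compose[OF smooth_into_chart_inv[OF G U]])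
        (auto intro!: smooth_on_bounded_linear bounded_linear_fst)
    moreover have "smooth_into A ?S (\<lambda>z. \<xi> (snd z *\<^sub>R v))"
      by (intro \<xi>_smooth smooth_on_bounded_linear bounded_linear_compose[OF bounded_linear_scaleR_left bounded_linear_snd])
        (auto intro: e(2))
    ultimately have "smooth_on ?S (\<lambda>z. f (inv_into U \<phi> (fst z) + \<xi> (snd z *\<^sub>R v)))"
      by (intro smooth_fun_smooth_into[OF G f] smooth_into_add[OF G])
    then have "smooth_on (\<phi> ` U) (\<lambda>a. deriv (\<lambda>t. (\<lambda>z. f (inv_into U \<phi> (fst z) + \<xi> (snd z *\<^sub>R v))) (a, t)) 0)"
      by (rule smooth_on_deriv_param) (use e(1) in \<open>auto intro!: exI[of _ \<epsilon>]\<close>)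
    then show "smooth_on (\<phi> ` U) (\<lambda>a. ?X f (inv_into U \<phi> a))" using f by simp
  qed
  \<comment> \<open>Since translation preserves smoothness in both directions, both sides fall into
    the same branch of the conditional, also for nonsmooth \<open>f\<close>.\<close>
  have "?X (\<lambda>x. f (g + x)) = (\<lambda>x. ?X f (g + x))" for g f
    by (simp add: smooth_fun_translate_iff[OF G] add.assoc cong: if_cong)
  then show ?thesis using tan smo by (simp add: lie_algebra_def smooth_vector_fields_def)
qed

text \<open>Apply the left invariant field with velocity \<open>l\<close> to a function with
  differential \<open>l\<close>. The result is \<open>l \<bullet> l\<close>, but it is also 0,
  because the field is a combination of brackets.\<close>

lemma perfect_functional_0:
  assumes perfect: "perfect_lie_algebra (lie_algebra A)"
    and N: "open N" "0 \<in> N" and l: "\<And>\<beta> w. \<beta> \<in> N \<Longrightarrow> l \<bullet> P (comm2 \<beta> w) = 0" and "l \<in> V"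
  shows "l = 0"
proof -
  obtain f N0 where f: "smooth_fun A f" and N0: "open N0" "0 \<in> N0"
    and fl: "\<And>x. x \<in> N0 \<Longrightarrow> x \<in> U0 \<and> f x = l \<bullet> \<eta> x"
    by (rule smooth_fun_with_differential[of l]) blast
  let ?X = "\<lambda>f p. if smooth_fun A f then deriv (\<lambda>t. f (p + \<xi> (t *\<^sub>R l))) 0 else 0"
  have "?X \<in> {(\<lambda>f p. \<Sum>i<n. a i * lie_bracket (X i) (Y i) f p) | (n::nat) (a :: nat \<Rightarrow> real) X Y.
            \<forall>i<n. X i \<in> lie_algebra A \<and> Y i \<in> lie_algebra A}"
    using perfect left_invariant_field[of l] unfolding perfect_lie_algebra_def by metis
  then obtain n :: nat and a :: "nat \<Rightarrow> real" and X Y where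
    X: "?X = (\<lambda>f p. \<Sum>i<n. a i * lie_bracket (X i) (Y i) f p)"
    and XY: "\<forall>i<n. X i \<in> lie_algebra A \<and> Y i \<in> lie_algebra A" by blast
  have "lie_bracket (X i) (Y i) f 0 = 0" if "i < n" for i
    using lie_bracket_functional_0[OF _ _ N l f N0 fl] XY that by blast
  then have "?X f 0 = 0" using fun_cong[OF fun_cong[OF X, of f], of 0] by simp
  then have d0: "deriv (\<lambda>t. f (\<xi> (t *\<^sub>R l))) 0 = 0" using f by simp
  obtain \<epsilon> where e: "\<epsilon> > 0" "\<And>t. t \<in> {-\<epsilon><..<\<epsilon>} \<Longrightarrow> t *\<^sub>R l \<in> \<Omega>" by (rule line_in_\<Omega>) blast
  have s: "smooth_into A {-\<epsilon><..<\<epsilon>} (\<lambda>t. \<xi> (t *\<^sub>R l))"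
    by (intro \<xi>_smooth smooth_on_bounded_linear bounded_linear_scaleR_left e(2))
  have o: "open {t \<in> {-\<epsilon><..<\<epsilon>}. \<xi> (t *\<^sub>R l) \<in> N0}"
    by (rule open_smooth_domain[OF _ s N0(1)]) simp
  have "((\<lambda>t. t * (l \<bullet> l)) has_real_derivative l \<bullet> l) (at 0)"
    by (auto intro!: derivative_eq_intros)
  then have "((\<lambda>t. f (\<xi> (t *\<^sub>R l))) has_real_derivative l \<bullet> l) (at 0)"
  proof (rule has_field_derivative_transform_within_open[OF _ o])
    show "0 \<in> {t \<in> {-\<epsilon><..<\<epsilon>}. \<xi> (t *\<^sub>R l) \<in> N0}" using e N0 by simp
    fix t assume "t \<in> {t \<in> {-\<epsilon><..<\<epsilon>}. \<xi> (t *\<^sub>R l) \<in> N0}"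
    moreover have "P (t *\<^sub>R l) = t *\<^sub>R l" using \<open>l \<in> V\<close> V_subspace by (simp add: P_id subspace_scale)
    ultimately show "t * (l \<bullet> l) = f (\<xi> (t *\<^sub>R l))" using fl e(2) by (simp add: \<eta>_\<xi>)
  qed
  then have "l \<bullet> l = 0" using d0 DERIV_imp_deriv by metis
  then show ?thesis by simp
qed

end

section \<open>Neighborhoods made of commutators\<close>

context lie_group_chart
begin

lemma comm2_P:
  assumes "\<beta> \<in> \<Omega>"
  shows "comm2 (P \<beta>) w = comm2 \<beta> w"
proof -
  have "(\<lambda>a. comm (P \<beta>, a)) = (\<lambda>a. comm (\<beta>, a))" by (simp add: comm_def)
  then show ?thesis
    using has_derivative_unique[OF has_derivative_comm2[of \<beta>]] has_derivative_comm2[of "P \<beta>"] assms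
    by (metis P_\<Omega>)
qed

lemma span_comm2_eq:
  assumes perfect: "perfect_lie_algebra (lie_algebra A)" and B: "0 \<in> interior (closure B)"
  shows "span {P (comm2 (\<eta> b) w) | b w. b \<in> B \<inter> U0} = V" (is "span ?Z = V")
proof (rule ccontr)
  assume "span ?Z \<noteq> V"
  moreover have "span ?Z \<subseteq> V" by (rule span_minimal) (auto intro: P_V V_subspace)
  ultimately have "span ?Z \<subset> V" by (intro psubsetI)
  moreover have spV: "span V = V" by (rule span_eq_iff[THEN iffD2, OF V_subspace])
  ultimately have "span ?Z \<subset> span V" by (simp only: spV)
  \<comment> \<open>It matters that \<open>l\<close> is found inside \<open>V\<close>: a vector
    orthogonal to \<open>V\<close> annihilates all values of \<open>P\<close> and would yield no
    contradiction.\<close>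
  then obtain l where l: "l \<noteq> 0" "l \<in> span V" "\<And>y. y \<in> span ?Z \<Longrightarrow> orthogonal l y"
    by (rule orthogonal_to_subspace_exists_gen) blast
  have lB: "l \<bullet> P (comm2 (\<eta> b) w) = 0" if "b \<in> B \<inter> U0" for b w
    using l(3)[of "P (comm2 (\<eta> b) w)"] that span_superset[of ?Z] by (auto simp: orthogonal_def)
  have lN: "l \<bullet> P (comm2 (\<eta> x) w) = 0" if x: "x \<in> U0" "x \<in> interior (closure B)" for x w
  proof (rule ccontr)
    assume ne: "l \<bullet> P (comm2 (\<eta> x) w) \<noteq> 0"
    have "continuous_on \<Omega> (\<lambda>\<beta>. l \<bullet> P (comm2 \<beta> w))"
      by (intro smooth_on_imp_continuous_on smooth_on_linear_compose[OF P_inner_bounded_linear] smooth_comm2)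
    then have "continuous_on U0 (\<lambda>x. l \<bullet> P (comm2 (\<eta> x) w))"
      by (rule continuous_on_compose2[OF _ continuous_on_\<eta>]) (use \<eta>_\<Omega> in blast)
    then have "open ((\<lambda>x. l \<bullet> P (comm2 (\<eta> x) w)) -` (- {0}) \<inter> U0)"
      using continuous_on_open_vimage[OF U0_open] by blast
    moreover have "x \<in> (\<lambda>x. l \<bullet> P (comm2 (\<eta> x) w)) -` (- {0}) \<inter> U0" using ne x by simp
    moreover have "x \<in> closure B" using x interior_subset by blast
    ultimately have "B \<inter> ((\<lambda>x. l \<bullet> P (comm2 (\<eta> x) w)) -` (- {0}) \<inter> U0) \<noteq> {}"
      unfolding closure_iff_nhds_not_empty by blast
    then show False using lB by auto
  qed
  let ?N = "{\<beta> \<in> \<Omega>. \<xi> \<beta> \<in> U0 \<inter> interior (closure B)}"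
  have "l = 0"
  proof (rule perfect_functional_0[OF perfect])
    show "open ?N"
      by (rule open_smooth_domain[OF \<Omega>_open smooth_into_\<xi>]) (simp add: U0_open open_Int)
    show "0 \<in> ?N" using zero_\<Omega> zero_U0 B by simp
    \<comment> \<open>Here \<open>\<beta>\<close> may lie outside \<open>V\<close>; passing through
      the group replaces it by \<open>P \<beta>\<close>, which does not change
      \<open>comm2\<close>.\<close>
    show "l \<bullet> P (comm2 \<beta> w) = 0" if "\<beta> \<in> ?N" for \<beta> w
      using lN[of "\<xi> \<beta>" w] that by (simp add: \<eta>_\<xi> comm2_P)
    show "l \<in> V" using l(2) by (simp only: spV)
  qed
  then show False using l(1) by simp
qed

text \<open>Continuity near 0 together with a derivative at the single point 0 suits the open
  mapping theorem used later and is preserved by sums in the group. The last clause says that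
  \<open>L\<close> takes its values in \<open>V\<close>.\<close>

definition germ_derivative :: "('e \<Rightarrow> 'g) \<Rightarrow> ('e \<Rightarrow> 'e) \<Rightarrow> bool" where
  "germ_derivative \<gamma> L \<longleftrightarrow> \<gamma> 0 = 0 \<and> (\<exists>S. open S \<and> 0 \<in> S \<and> continuous_on S \<gamma> \<and> \<gamma> ` S \<subseteq> U0) \<and>
     ((\<lambda>x. \<eta> (\<gamma> x)) has_derivative L) (at 0) \<and> (\<forall>u. P (L u) = L u)"

lemma germ_derivative_0: "germ_derivative (\<lambda>x. 0) (\<lambda>u. 0)"
  unfolding germ_derivative_def using zero_U0 by (auto intro!: exI[of _ UNIV])

text \<open>Both maps start at the neutral element, where the differential of the multiplication is
  addition.\<close>

lemma germ_derivative_add: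
  assumes "germ_derivative \<gamma> L" "germ_derivative \<gamma>' L'"
  shows "germ_derivative (\<lambda>x. \<gamma> x + \<gamma>' x) (\<lambda>u. L u + L' u)"
proof -
  obtain S where S: "open S" "0 \<in> S" "continuous_on S \<gamma>" "\<gamma> ` S \<subseteq> U0"
    using assms(1) unfolding germ_derivative_def by blast
  obtain S' where S': "open S'" "0 \<in> S'" "continuous_on S' \<gamma>'" "\<gamma>' ` S' \<subseteq> U0"
    using assms(2) unfolding germ_derivative_def by blast
  have 0: "\<gamma> 0 = 0" "\<gamma>' 0 = 0" and P: "P (L u) = L u" "P (L' u) = L' u" for u
    using assms unfolding germ_derivative_def by auto
  have D: "((\<lambda>x. \<eta> (\<gamma> x)) has_derivative L) (at 0)" "((\<lambda>x. \<eta> (\<gamma>' x)) has_derivative L') (at 0)"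
    using assms unfolding germ_derivative_def by auto
  let ?T = "(\<lambda>x. \<gamma> x + \<gamma>' x) -` U0 \<inter> (S \<inter> S')"
  have c: "continuous_on (S \<inter> S') (\<lambda>x. \<gamma> x + \<gamma>' x)"
    by (intro continuous_on_add continuous_on_subset[OF S(3)] continuous_on_subset[OF S'(3)]) auto
  then have T: "open ?T"
    using continuous_on_open_vimage[of "S \<inter> S'"] S(1) S'(1) U0_open by (metis open_Int)
  have T0: "0 \<in> ?T" using S(2) S'(2) 0 zero_U0 by simp
  have "((\<lambda>x. (\<eta> (\<gamma> x), \<eta> (\<gamma>' x))) has_derivative (\<lambda>u. (L u, L' u))) (at 0)"
    by (intro has_derivative_Pair D)
  moreover have "(mul has_derivative frechet_derivative mul (at (0, 0))) (at (\<eta> (\<gamma> 0), \<eta> (\<gamma>' 0)))"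
    using has_derivative_mul[of "(0, 0)"] zero_\<Omega> by (simp add: 0)
  ultimately have "((\<lambda>x. mul (\<eta> (\<gamma> x), \<eta> (\<gamma>' x))) has_derivative
      (\<lambda>u. frechet_derivative mul (at (0, 0)) (L u, L' u))) (at 0)"
    by (rule has_derivative_compose)
  then have "((\<lambda>x. \<eta> (\<gamma> x + \<gamma>' x)) has_derivative
      (\<lambda>u. frechet_derivative mul (at (0, 0)) (L u, L' u))) (at 0)"
    by (rule has_derivative_transform_within_open[OF _ T T0])
      (use S(4) S'(4) in \<open>auto simp: mul_def \<xi>_\<eta> image_subset_iff\<close>)
  then have "((\<lambda>x. \<eta> (\<gamma> x + \<gamma>' x)) has_derivative (\<lambda>u. L u + L' u)) (at 0)"
    by (simp add: derivative_mul_0 P)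
  moreover have "continuous_on ?T (\<lambda>x. \<gamma> x + \<gamma>' x)" by (rule continuous_on_subset[OF c]) auto
  ultimately show ?thesis
    unfolding germ_derivative_def using T T0 0 P linear_add[OF P_linear]
    by (intro conjI exI[of _ ?T]) auto
qed

text \<open>The entry \<open>b\<close> is frozen and may be far from 0 inside the chart; only the
  first entry moves, along a line and with speed given by the scalar functional
  \<open>c\<close>.\<close>

lemma germ_derivative_commutator:
  assumes c: "bounded_linear (c :: 'e \<Rightarrow> real)" and b: "b \<in> U0"
  shows "germ_derivative (\<lambda>x. \<xi> (c x *\<^sub>R w) + b - \<xi> (c x *\<^sub>R w) - b) (\<lambda>x. c x *\<^sub>R P (comm2 (\<eta> b) w))"
    (is "germ_derivative ?\<gamma> ?L")
proof -
  have lin: "bounded_linear (\<lambda>x. c x *\<^sub>R w)"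
    by (rule bounded_linear_compose[OF bounded_linear_scaleR_left c])
  have c0: "c 0 = 0" using c by (simp add: bounded_linear.linear linear_0)
  let ?S = "(\<lambda>x. c x *\<^sub>R w) -` \<Omega>"
  have S: "open ?S" by (intro open_vimage \<Omega>_open linear_continuous_on[OF lin])
  have s: "smooth_into A ?S ?\<gamma>"
    unfolding diff_conv_add_uminus
    by (intro smooth_into_add[OF G] smooth_into_minus[OF G] smooth_into_const \<xi>_smooth
        smooth_on_bounded_linear[OF lin]) auto
  let ?T = "{x \<in> ?S. ?\<gamma> x \<in> U0}"
  have T: "open ?T" by (rule open_smooth_domain[OF S s U0_open])
  have T0: "0 \<in> ?T" using zero_\<Omega> zero_U0 by (simp add: c0)
  have "((\<lambda>x. c x *\<^sub>R w) has_derivative (\<lambda>x. c x *\<^sub>R w)) (at 0)"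
    by (rule bounded_linear_imp_has_derivative[OF lin])
  moreover have "((\<lambda>a. comm (\<eta> b, a)) has_derivative comm2 (\<eta> b)) (at (c 0 *\<^sub>R w))"
    using has_derivative_comm2[OF \<eta>_\<Omega>[OF b]] by (simp add: c0)
  ultimately have "((\<lambda>x. comm (\<eta> b, c x *\<^sub>R w)) has_derivative (\<lambda>x. comm2 (\<eta> b) (c x *\<^sub>R w))) (at 0)"
    by (rule has_derivative_compose)
  then have "((\<lambda>x. P (comm (\<eta> b, c x *\<^sub>R w))) has_derivative (\<lambda>x. P (comm2 (\<eta> b) (c x *\<^sub>R w)))) (at 0)"
    by (rule bounded_linear.has_derivative[OF P_bounded_linear])
  then have "((\<lambda>x. \<eta> (?\<gamma> x)) has_derivative (\<lambda>x. P (comm2 (\<eta> b) (c x *\<^sub>R w)))) (at 0)"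
    by (rule has_derivative_transform_within_open[OF _ T T0]) (simp add: comm_def \<xi>_\<eta>[OF b] P_\<eta>)
  then have "((\<lambda>x. \<eta> (?\<gamma> x)) has_derivative ?L) (at 0)"
    by (simp add: linear_cmul[OF comm2_linear[OF \<eta>_\<Omega>[OF b]]] linear_cmul[OF P_linear])
  moreover have "continuous_on ?T ?\<gamma>"
    by (rule continuous_on_subset[OF smooth_intoD(1)[OF s]]) auto
  ultimately show ?thesis
    unfolding germ_derivative_def using T T0 linear_cmul[OF P_linear]
    by (intro conjI exI[of _ ?T]) (auto simp: c0)
qed

lemma commutator_sums_nbhd:
  fixes B K :: "'g set"
  assumes perfect: "perfect_lie_algebra (lie_algebra A)" and B: "0 \<in> interior (closure B)"
    and K: "open K" "0 \<in> K"
  shows "0 \<in> interior {sum_list (map (\<lambda>(a, b). a + b - a - b) zs) | zs. length zs = dim V \<and> set zs \<subseteq> K \<times> B}"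
    (is "_ \<in> interior ?R")
proof -
  obtain Z where Z: "Z \<subseteq> {P (comm2 (\<eta> b) w) | b w. b \<in> B \<inter> U0}" "independent Z"
    "{P (comm2 (\<eta> b) w) | b w. b \<in> B \<inter> U0} \<subseteq> span Z"
    by (rule maximal_independent_subset)
  have ZV: "span Z = V"
    using span_comm2_eq[OF perfect B] Z span_mono[OF Z(1)] span_minimal[OF Z(3)] by auto
  have finZ: "finite Z" using Z(2) by (rule independent_imp_finite)
  have cardZ: "card Z = dim V" using dim_eq_card_independent[OF Z(2)] ZV by (metis dim_span)
  have "\<forall>z\<in>Z. \<exists>b w. b \<in> B \<inter> U0 \<and> z = P (comm2 (\<eta> b) w)" using Z(1) by blast
  then obtain b w where bw: "\<And>z. z \<in> Z \<Longrightarrow> b z \<in> B \<inter> U0 \<and> z = P (comm2 (\<eta> (b z)) (w z))"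
    by metis
  \<comment> \<open>The coordinate of \<open>P x\<close> with respect to the basis vector
    \<open>z\<close>.\<close>
  define c where "c z x = representation Z (P x) z" for z x
  have c_lin: "bounded_linear (c z)" for z
  proof -
    have "linear (c z)"
      by (rule linearI)
        (simp_all add: c_def linear_add[OF P_linear] linear_cmul[OF P_linear] representation_add[OF Z(2)]
          representation_scale[OF Z(2)] ZV P_V)
    then show ?thesis by (simp add: linear_conv_bounded_linear)
  qed
  have c_sum: "(\<Sum>z\<in>Z. c z x *\<^sub>R z) = P x" for x
    unfolding c_def by (rule sum_representation_eq[OF Z(2) _ finZ]) (simp_all add: ZV P_V)
  \<comment> \<open>The group sum depends on the order of its terms, so the basis is enumerated once
    and for all.\<close>
  obtain zl where zl: "set zl = Z" "distinct zl" using finite_distinct_list[OF finZ] by blast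
  define \<gamma> where "\<gamma> z x = \<xi> (c z x *\<^sub>R w z) + b z - \<xi> (c z x *\<^sub>R w z) - b z" for z x
  have germ: "germ_derivative (\<gamma> z) (\<lambda>x. c z x *\<^sub>R z)" if "z \<in> Z" for z
    unfolding \<gamma>_def using germ_derivative_commutator[OF c_lin, of "b z" z "w z"] bw[OF that] by auto
  have "germ_derivative (\<lambda>x. sum_list (map (\<lambda>z. \<gamma> z x) l)) (\<lambda>x. sum_list (map (\<lambda>z. c z x *\<^sub>R z) l))"
    if "set l \<subseteq> Z" for l
    using that by (induction l) (auto intro: germ_derivative_0 germ_derivative_add germ)
  from this[of zl] have "germ_derivative (\<lambda>x. sum_list (map (\<lambda>z. \<gamma> z x) zl)) P"
    using zl c_sum by (simp add: sum_list_distinct_conv_sum_set)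
  moreover define \<Gamma> where "\<Gamma> x = sum_list (map (\<lambda>z. \<gamma> z x) zl)" for x
  ultimately have germ_\<Gamma>: "germ_derivative \<Gamma> P" by (simp add: \<Gamma>_def[abs_def])
  obtain S where S: "open S" "0 \<in> S" "continuous_on S \<Gamma>" "\<Gamma> ` S \<subseteq> U0"
    using germ_\<Gamma> unfolding germ_derivative_def by blast
  \<comment> \<open>In coordinates \<open>\<Gamma>\<close> reaches only \<open>V\<close>. Adding the
    component of \<open>x\<close> in the kernel of \<open>P\<close> gives a map of the whole
    Euclidean space with derivative the identity; applying \<open>P\<close> removes it again
    below.\<close>
  define \<Psi> where "\<Psi> x = \<eta> (\<Gamma> x) + (x - P x)" for x
  have "(\<Psi> has_derivative (\<lambda>u. P u + (u - P u))) (at 0)"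
    unfolding \<Psi>_def[abs_def] using germ_\<Gamma> unfolding germ_derivative_def
    by (intro has_derivative_add has_derivative_diff P_has_derivative has_derivative_ident) auto
  then have d\<Psi>: "(\<Psi> has_derivative (\<lambda>u. u)) (at 0)" by simp
  have c\<Psi>: "continuous_on S \<Psi>" unfolding \<Psi>_def
    by (intro continuous_on_add continuous_on_diff continuous_on_id
        continuous_on_compose2[OF continuous_on_\<eta> S(3,4)] linear_continuous_on[OF P_bounded_linear])
  \<comment> \<open>On \<open>T\<close> the first entries of all the commutators lie in
    \<open>K\<close>.\<close>
  define T where "T = S \<inter> (\<Inter>z\<in>Z. (\<lambda>x. c z x *\<^sub>R w z) -` {a \<in> \<Omega>. \<xi> a \<in> K})"
  have "open T" unfolding T_def
    by (intro open_Int S(1) open_INT finZ ballI open_vimage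
        open_smooth_domain[OF \<Omega>_open smooth_into_\<xi> K(1)]
        linear_continuous_on[OF bounded_linear_compose[OF bounded_linear_scaleR_left c_lin]])
  moreover have "c z 0 = 0" for z using c_lin[of z] by (simp add: bounded_linear.linear linear_0)
  then have "0 \<in> T" using S(2) zero_\<Omega> K(2) by (simp add: T_def)
  ultimately have "0 \<in> interior T" by (simp add: interior_open)
  \<comment> \<open>The open mapping theorem for a continuous map whose derivative at one point has
    a right inverse, here the identity.\<close>
  have "\<Psi> 0 \<in> interior (\<Psi> ` T)"
    by (rule sussmann_open_mapping[OF S(1) c\<Psi> S(2) d\<Psi> bounded_linear_ident _ _ \<open>0 \<in> interior T\<close>])
      (auto simp: T_def)
  moreover have "\<Psi> 0 = 0" using germ_\<Gamma> by (simp add: \<Psi>_def germ_derivative_def)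
  ultimately have int: "0 \<in> interior (\<Psi> ` T)" by simp
  let ?N = "\<eta> -` interior (\<Psi> ` T) \<inter> U0"
  have "?N \<subseteq> ?R"
  proof
    fix y assume y: "y \<in> ?N"
    then obtain x where x: "x \<in> T" "\<eta> y = \<Psi> x" using interior_subset by blast
    then have \<Gamma>x: "\<Gamma> x \<in> U0" using S(4) by (auto simp: T_def)
    have "\<eta> y = P (\<Psi> x)" using x(2) P_\<eta>[of y] y by simp
    also have "\<dots> = \<eta> (\<Gamma> x)"
      using \<Gamma>x by (simp add: \<Psi>_def linear_add[OF P_linear] linear_diff[OF P_linear] P_\<eta>)
    finally have "y = \<Gamma> x" using \<xi>_\<eta>[OF \<Gamma>x] \<xi>_\<eta>[of y] y by auto
    then have "y = sum_list (map (\<lambda>(a, b). a + b - a - b) (map (\<lambda>z. (\<xi> (c z x *\<^sub>R w z), b z)) zl))"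
      by (simp add: \<Gamma>_def \<gamma>_def o_def)
    moreover have "length (map (\<lambda>z. (\<xi> (c z x *\<^sub>R w z), b z)) zl) = dim V"
      using distinct_card[OF zl(2)] zl(1) cardZ by simp
    moreover have "set (map (\<lambda>z. (\<xi> (c z x *\<^sub>R w z), b z)) zl) \<subseteq> K \<times> B"
      using x(1) bw zl(1) by (auto simp: T_def)
    ultimately show "y \<in> ?R" by blast
  qed
  moreover have "open ?N"
    using continuous_on_open_vimage[OF U0_open] continuous_on_\<eta> by (metis open_interior)
  moreover have "0 \<in> ?N" using int zero_U0 by simp
  ultimately show ?thesis by (meson interiorI)
qed

end

section \<open>Continuity\<close>

lemma group_hom_zero_minus:
  fixes \<psi> :: "'g::group_add \<Rightarrow> 'h::group_add"
  assumes "\<And>x y. \<psi> (x + y) = \<psi> x + \<psi> y"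
  shows "\<psi> 0 = 0" "\<psi> (- x) = - \<psi> x"
proof -
  show 0: "\<psi> 0 = 0" using assms[of 0 0] add_left_cancel[of "\<psi> 0" "\<psi> 0" 0] by simp
  show "\<psi> (- x) = - \<psi> x"
    using assms[of "- x" x] 0 by (simp add: eq_neg_iff_add_eq_0)
qed

lemma compact_set_plus:
  fixes S T :: "'g::topological_monoid_add set"
  assumes "compact S" "compact T"
  shows "compact (S + T)"
proof -
  have "S + T = (\<lambda>z. fst z + snd z) ` (S \<times> T)" by (force simp: set_plus_def)
  moreover have "compact ((\<lambda>z. fst z + snd z) ` (S \<times> T))"
    by (intro compact_continuous_image compact_Times assms continuous_intros)
  ultimately show ?thesis by simp
qed

text \<open>Each factor is sent into a translate of the difference set of the compact set
  \<open>D\<close>. Finite products of compact sets are compact, so the algebra of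
  \<open>\<psi>\<close> alone suffices.\<close>

lemma hom_image_spacious_product:
  fixes \<psi> :: "'g::topological_group_add \<Rightarrow> 'h::topological_group_add"
  assumes hom: "\<And>x y. \<psi> (x + y) = \<psi> x + \<psi> y" and D: "compact D" "\<psi> ` C \<subseteq> D"
  shows "\<exists>E. compact E \<and> \<psi> ` sum_list (map (\<lambda>g. g +o (C + uminus ` C)) gs) \<subseteq> E"
proof (induction gs)
  case Nil
  show ?case using group_hom_zero_minus(1)[OF hom] by (intro exI[of _ "{0}"]) simp
next
  case (Cons g gs)
  then obtain E where E: "compact E" "\<psi> ` sum_list (map (\<lambda>g. g +o (C + uminus ` C)) gs) \<subseteq> E" by blast
  let ?E = "({\<psi> g} + (D + uminus ` D)) + E"
  have "compact ?E"
    by (intro compact_set_plus compact_continuous_image D E continuous_intros) auto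
  moreover have "\<psi> ` sum_list (map (\<lambda>g. g +o (C + uminus ` C)) (g # gs)) \<subseteq> ?E"
  proof
    fix h assume "h \<in> \<psi> ` sum_list (map (\<lambda>g. g +o (C + uminus ` C)) (g # gs))"
    then obtain a b r where *: "a \<in> C" "b \<in> C" "r \<in> sum_list (map (\<lambda>g. g +o (C + uminus ` C)) gs)"
      "h = \<psi> (g + (a + - b) + r)"
      by (auto simp: set_plus_def elt_set_plus_def)
    then have "h = \<psi> g + (\<psi> a + - \<psi> b) + \<psi> r"
      by (simp only: hom group_hom_zero_minus(2)[of \<psi>, OF hom])
    moreover have "\<psi> a \<in> D" "- \<psi> b \<in> uminus ` D" "\<psi> r \<in> E" using * D(2) E(2) by auto
    ultimately show "h \<in> ?E" by (metis set_plus_intro singletonI)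
  qed
  ultimately show ?case by blast
qed

text \<open>A finite union of closed sets with empty interior has empty interior, in any topological
  space.\<close>

lemma interior_finite_Union_closure:
  assumes "finite I" "interior (\<Union>i\<in>I. S i) \<noteq> {}"
  shows "\<exists>i\<in>I. interior (closure (S i)) \<noteq> {}"
proof (rule ccontr)
  assume "\<not> ?thesis"
  then have e: "\<forall>i\<in>I. interior (closure (S i)) = {}" by blast
  from assms(1) e have "interior (\<Union>i\<in>I. closure (S i)) = {}"
  proof (induction I rule: finite_induct)
    case (insert i I)
    then show ?case
      using interior_closed_Un_empty_interior[of "closure (S i)" "\<Union>i\<in>I. closure (S i)"] by simp
  qed simp
  moreover have "(\<Union>i\<in>I. S i) \<subseteq> (\<Union>i\<in>I. closure (S i))" using closure_subset by blast
  ultimately show False using assms(2) interior_mono by blast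
qed

lemma continuous_translate:
  fixes a :: "'a::topological_monoid_add"
  shows "continuous_on S (\<lambda>x. a + x)"
  by (intro continuous_intros)

lemma open_sub_nbhd:
  fixes W :: "'h::topological_group_add set"
  assumes "open W" "0 \<in> W"
  obtains W' where "open W'" "0 \<in> W'" "\<And>x y. x \<in> W' \<Longrightarrow> y \<in> W' \<Longrightarrow> - x + y \<in> W"
proof -
  have "open ((\<lambda>z. - fst z + snd z) -` W :: ('h \<times> 'h) set)"
    by (intro open_vimage assms continuous_intros)
  moreover have "(0, 0) \<in> (\<lambda>z. - fst z + snd z) -` W" using assms by simp
  ultimately obtain U1 U2 where "open U1" "open U2" "(0, 0) \<in> U1 \<times> U2"
      "U1 \<times> U2 \<subseteq> (\<lambda>z. - fst z + snd z) -` W"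
    by (rule open_prod_elim) blast
  then show thesis using that[of "U1 \<inter> U2"] by fastforce
qed

lemma open_sum_list_nbhd:
  fixes W :: "'h::topological_monoid_add set"
  assumes "open W" "0 \<in> W"
  shows "\<exists>W'. open W' \<and> 0 \<in> W' \<and> (\<forall>xs. length xs = n \<and> set xs \<subseteq> W' \<longrightarrow> sum_list xs \<in> W)"
  using assms
proof (induction n arbitrary: W)
  case 0
  then show ?case by (intro exI[of _ W]) auto
next
  case (Suc n)
  have "open ((\<lambda>z. fst z + snd z) -` W :: ('h \<times> 'h) set)"
    by (intro open_vimage Suc.prems continuous_intros)
  moreover have "(0, 0) \<in> (\<lambda>z. fst z + snd z) -` W" using Suc.prems by simp
  ultimately obtain U1 U2 where U: "open U1" "open U2" "(0, 0) \<in> U1 \<times> U2"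
      "U1 \<times> U2 \<subseteq> (\<lambda>z. fst z + snd z) -` W"
    by (rule open_prod_elim) blast
  then obtain W' where W': "open W'" "0 \<in> W'" "\<forall>xs. length xs = n \<and> set xs \<subseteq> W' \<longrightarrow> sum_list xs \<in> U2"
    using Suc.IH[of U2] by blast
  have "sum_list xs \<in> W" if "length xs = Suc n" "set xs \<subseteq> U1 \<inter> W'" for xs
  proof -
    obtain y ys where "xs = y # ys" "length ys = n" using \<open>length xs = Suc n\<close> by (auto simp: length_Suc_conv)
    moreover from this have "(y, sum_list ys) \<in> U1 \<times> U2" using that(2) W'(3) by simp
    ultimately show ?thesis using U(4) by auto
  qed
  then show ?case using U W' by (intro exI[of _ "U1 \<inter> W'"]) auto
qed

text \<open>For \<open>w = 0\<close> the commutator is 0 for every \<open>d\<close>, and the tube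
  lemma makes this uniform over the compact set \<open>D\<close>.\<close>

lemma compact_commutator_nbhd:
  fixes W :: "'h::topological_group_add set"
  assumes "compact D" "open W" "0 \<in> W"
  obtains W' where "open W'" "0 \<in> W'" "\<And>d w. d \<in> D \<Longrightarrow> w \<in> W' \<Longrightarrow> d + w - d - w \<in> W"
proof -
  have "open ((\<lambda>z. snd z + fst z - snd z - fst z) -` W :: ('h \<times> 'h) set)"
    by (intro open_vimage assms continuous_intros)
  moreover have "{0} \<times> D \<subseteq> (\<lambda>z. snd z + fst z - snd z - fst z) -` W"
    using assms by auto
  ultimately have "\<exists>X0. 0 \<in> X0 \<and> open X0 \<and> X0 \<times> D \<subseteq> (\<lambda>z. snd z + fst z - snd z - fst z) -` W"
    by (rule Elementary_Topology.tube_lemma[OF assms(1)])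
  then obtain X0 where "0 \<in> X0" "open X0" "X0 \<times> D \<subseteq> (\<lambda>z. snd z + fst z - snd z - fst z) -` W" by blast
  then show thesis using that[of X0] by fastforce
qed

text \<open>A finite cover of \<open>D\<close> by small translates splits \<open>K\<close> into
  finitely many pieces, one of which is dense somewhere. Differences of elements of that piece are
  sent into \<open>W\<close>.\<close>

lemma preimage_dense_near_0:
  fixes \<psi> :: "'g::topological_group_add \<Rightarrow> 'h::topological_group_add"
  assumes hom: "\<And>x y. \<psi> (x + y) = \<psi> x + \<psi> y"
    and K: "interior K \<noteq> {}" "\<psi> ` K \<subseteq> D" "compact D" and W: "open W" "0 \<in> W"
  shows "0 \<in> interior (closure (\<psi> -` W))"
proof -
  obtain W' where W': "open W'" "0 \<in> W'" "\<And>x y. x \<in> W' \<Longrightarrow> y \<in> W' \<Longrightarrow> - x + y \<in> W"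
    by (rule open_sub_nbhd[OF W]) blast
  let ?U = "\<lambda>d. (\<lambda>h. - d + h) -` W'"
  have "open (?U d)" for d by (intro open_vimage W' continuous_translate)
  moreover have "D \<subseteq> (\<Union>d\<in>D. ?U d)" using W'(2) by auto
  ultimately obtain F where F: "F \<subseteq> D" "finite F" "D \<subseteq> (\<Union>d\<in>F. ?U d)"
    using compactE_image[OF K(3), of D ?U] by metis
  let ?K = "\<lambda>d. {x \<in> K. \<psi> x \<in> ?U d}"
  have "K \<subseteq> (\<Union>d\<in>F. ?K d)" using F(3) K(2) by blast
  then have "interior (\<Union>d\<in>F. ?K d) \<noteq> {}" using K(1) interior_mono by blast
  then obtain d where d: "interior (closure (?K d)) \<noteq> {}"
    using interior_finite_Union_closure[OF F(2)] by blast
  let ?O = "interior (closure (?K d))"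
  \<comment> \<open>\<open>x0\<close> is taken in the piece itself, not merely in its closure, since
    its image must lie in the translate belonging to \<open>d\<close>.\<close>
  obtain x0 where x0: "x0 \<in> ?O" "x0 \<in> ?K d"
    using d open_Int_closure_eq_empty[OF open_interior, of "closure (?K d)" "?K d"] interior_subset
    by (metis (no_types, lifting) disjoint_iff inf.absorb_iff2 inf_commute)
  let ?N = "(\<lambda>g. x0 + g) -` ?O"
  have "?N \<subseteq> closure (\<psi> -` W)"
  proof
    fix g assume "g \<in> ?N"
    then have g: "x0 + g \<in> closure (?K d)" using interior_subset by blast
    show "g \<in> closure (\<psi> -` W)"
      unfolding closure_iff_nhds_not_empty
    proof (intro allI impI)
      fix A U assume AU: "U \<subseteq> A" "g \<in> U" "open U"
      have "open ((\<lambda>y. - x0 + y) -` U)" by (intro open_vimage AU continuous_translate)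
      moreover have "x0 + g \<in> (\<lambda>y. - x0 + y) -` U" using AU by (simp add: add.assoc[symmetric])
      ultimately have "?K d \<inter> (\<lambda>y. - x0 + y) -` U \<noteq> {}"
        using g unfolding closure_iff_nhds_not_empty by blast
      then obtain y where y: "y \<in> ?K d" "- x0 + y \<in> U" by blast
      \<comment> \<open>The unknown center \<open>d\<close> cancels.\<close>
      have "\<psi> (- x0 + y) = - (- d + \<psi> x0) + (- d + \<psi> y)"
        by (simp add: hom group_hom_zero_minus(2)[of \<psi>, OF hom] minus_add add.assoc)
      then have "\<psi> (- x0 + y) \<in> W" using W'(3) x0(2) y(1) by simp
      then show "\<psi> -` W \<inter> A \<noteq> {}" using y(2) AU(1) by blast
    qed
  qed
  moreover have "open ?N" by (intro open_vimage open_interior continuous_translate)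
  moreover have "0 \<in> ?N" using x0(1) by simp
  ultimately show ?thesis by (meson interiorI)
qed

lemma hom_continuous_if_continuous_at_0:
  fixes \<psi> :: "'g::topological_group_add \<Rightarrow> 'h::topological_group_add"
  assumes hom: "\<And>x y. \<psi> (x + y) = \<psi> x + \<psi> y"
    and 0: "\<And>W. open W \<Longrightarrow> 0 \<in> W \<Longrightarrow> 0 \<in> interior (\<psi> -` W)"
  shows "continuous_on UNIV \<psi>"
  unfolding continuous_on_open_vimage[OF open_UNIV]
proof (intro allI impI)
  fix W :: "'h set" assume W: "open W"
  have "\<exists>T. open T \<and> x \<in> T \<and> T \<subseteq> \<psi> -` W" if x: "\<psi> x \<in> W" for x
  proof -
    have "0 \<in> interior (\<psi> -` ((\<lambda>h. \<psi> x + h) -` W))"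
      by (rule 0) (use x in \<open>auto intro!: open_vimage W continuous_translate\<close>)
    moreover have "y \<in> \<psi> -` W" if "- x + y \<in> interior (\<psi> -` ((\<lambda>h. \<psi> x + h) -` W))" for y
    proof -
      have "\<psi> x + \<psi> (- x + y) \<in> W" using that interior_subset by blast
      then show ?thesis by (simp add: hom[symmetric] add.assoc[symmetric])
    qed
    ultimately show ?thesis
      by (intro exI[of _ "(\<lambda>y. - x + y) -` interior (\<psi> -` ((\<lambda>h. \<psi> x + h) -` W))"])
        (auto intro!: open_vimage continuous_translate)
  qed
  then show "open (\<psi> -` W \<inter> UNIV)" by (subst open_subopen) auto
qed

lemma subspace_projection:
  fixes V :: "'a::euclidean_space set"
  assumes "subspace V"
  obtains P where "linear P" "\<And>x. P x \<in> V" "\<And>x. x \<in> V \<Longrightarrow> P x = x"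
proof -
  obtain B where B: "B \<subseteq> V" "pairwise orthogonal B" "\<And>x. x \<in> B \<Longrightarrow> norm x = 1" "independent B" "span B = V"
    using orthonormal_basis_subspace[OF assms] by metis
  have fin: "finite B" using B(4) by (rule independent_imp_finite)
  define P where "P x = (\<Sum>b\<in>B. (x \<bullet> b) *\<^sub>R b)" for x
  have lin: "linear P"
    unfolding P_def[abs_def] by (intro linear_compose_sum ballI linearI) (simp_all add: inner_add_left scaleR_add_left)
  have "P x \<in> V" for x
    unfolding P_def using B(1) by (intro subspace_sum[OF assms] subspace_scale[OF assms]) auto
  moreover have "P x = x" if "x \<in> V" for x
  proof (rule linear_eq_on_span[OF lin linear_ident])
    show "x \<in> span B" using that B(5) by simp
    fix b assume b: "b \<in> B"
    have "(b \<bullet> b') *\<^sub>R b' = (if b' = b then b else 0)" if "b' \<in> B" for b'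
      using B(2,3) b that by (auto simp: pairwise_def orthogonal_def dot_square_norm)
    then have "P b = (\<Sum>b'\<in>B. if b' = b then b else 0)" unfolding P_def by (rule sum.cong[OF refl])
    then show "P b = b" using fin b by simp
  qed
  ultimately show thesis using that lin by blast
qed

theorem theoremD:
  fixes V :: "'e::euclidean_space set"
    and A :: "('g::{topological_group_add,t2_space}, 'e) chart set"
    and \<psi> :: "'g \<Rightarrow> 'h::{topological_group_add,t2_space}"
    and C :: "'g set"
  assumes "lie_group V A"
    and "\<And>x y. \<psi> (x + y) = \<psi> x + \<psi> y"
    and "perfect_lie_algebra (lie_algebra A)"
    and "compact C" and "spacious C"
    and "compact (closure (\<psi> ` C))"
  shows "continuous_on UNIV \<psi>"
proof -
  note hom = assms(2)
  have "subspace V" using assms(1) by (simp add: lie_group_def)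
  then obtain P where P: "linear P" "\<And>x. P x \<in> V" "\<And>x. x \<in> V \<Longrightarrow> P x = x" by (rule subspace_projection) blast
  obtain U \<phi> where U: "(U, \<phi>) \<in> A" "0 \<in> U" by (rule chart_at[OF assms(1)])
  interpret lie_group_chart V A U \<phi> P
    by (rule lie_group_chart.intro[OF assms(1) U P])
  obtain gs where gs: "interior (sum_list (map (\<lambda>g. g +o (C + uminus ` C)) gs)) \<noteq> {}"
    using assms(5) unfolding spacious_def by blast
  let ?S = "sum_list (map (\<lambda>g. g +o (C + uminus ` C)) gs)"
  obtain E where E: "compact E" "\<psi> ` ?S \<subseteq> E"
    using hom_image_spacious_product[of \<psi>, OF hom assms(6) closure_subset] by blast
  \<comment> \<open>Shifting by an interior point \<open>k\<close> makes \<open>K\<close> a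
    neighborhood of 0, and the compact set is shifted by the image of \<open>k\<close>
    accordingly.\<close>
  obtain k where k: "k \<in> interior ?S" using gs by blast
  define K where "K = (\<lambda>x. k + x) -` interior ?S"
  define D where "D = (\<lambda>h. - \<psi> k + h) ` E"
  have K: "open K" "0 \<in> K" using k by (auto simp: K_def intro!: open_vimage continuous_translate)
  have D: "compact D" unfolding D_def by (intro compact_continuous_image continuous_translate E)
  have KD: "\<psi> ` K \<subseteq> D"
  proof
    fix h assume "h \<in> \<psi> ` K"
    then obtain x where x: "k + x \<in> interior ?S" "h = \<psi> x" by (auto simp: K_def)
    then have "\<psi> (k + x) \<in> E" using E(2) interior_subset by blast
    moreover have "h = - \<psi> k + \<psi> (k + x)" using x(2) by (simp add: hom add.assoc[symmetric])
    ultimately show "h \<in> D" unfolding D_def by blast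
  qed
  show ?thesis
  proof (rule hom_continuous_if_continuous_at_0[OF hom])
    fix W :: "'h set" assume W: "open W" "0 \<in> W"
    \<comment> \<open>The order of choices matters: \<open>W1\<close> absorbs sums of
      \<open>dim V\<close> terms, a number known before \<open>W2\<close> and the dense set are
      determined.\<close>
    obtain W1 where W1: "open W1" "0 \<in> W1" "\<forall>xs. length xs = dim V \<and> set xs \<subseteq> W1 \<longrightarrow> sum_list xs \<in> W"
      using open_sum_list_nbhd[OF W, of "dim V"] by blast
    obtain W2 where W2: "open W2" "0 \<in> W2" "\<And>d w. d \<in> D \<Longrightarrow> w \<in> W2 \<Longrightarrow> d + w - d - w \<in> W1"
      by (rule compact_commutator_nbhd[OF D W1(1,2)]) blast
    have "interior K \<noteq> {}" using K by (metis empty_iff interior_open)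
    then have "0 \<in> interior (closure (\<psi> -` W2))"
      by (rule preimage_dense_near_0[of \<psi>, OF hom _ KD D W2(1,2)])
    then have "0 \<in> interior {sum_list (map (\<lambda>(a, b). a + b - a - b) zs) | zs.
        length zs = dim V \<and> set zs \<subseteq> K \<times> (\<psi> -` W2)}"
      by (rule commutator_sums_nbhd[OF assms(3) _ K])
    moreover have "{sum_list (map (\<lambda>(a, b). a + b - a - b) zs) | zs.
        length zs = dim V \<and> set zs \<subseteq> K \<times> (\<psi> -` W2)} \<subseteq> \<psi> -` W"
    proof clarify
      fix zs :: "('g \<times> 'g) list" assume zs: "length zs = dim V" "set zs \<subseteq> K \<times> (\<psi> -` W2)"
      have "\<psi> (sum_list xs) = sum_list (map \<psi> xs)" for xs
        by (induction xs) (simp_all add: hom group_hom_zero_minus(1)[of \<psi>, OF hom])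
      moreover have "set (map \<psi> (map (\<lambda>(a, b). a + b - a - b) zs)) \<subseteq> W1"
      proof
        fix h assume "h \<in> set (map \<psi> (map (\<lambda>(a, b). a + b - a - b) zs))"
        then obtain a b where ab: "(a, b) \<in> set zs" "h = \<psi> (a + b - a - b)" by auto
        then have "h = \<psi> a + \<psi> b - \<psi> a - \<psi> b"
          by (simp only: diff_conv_add_uminus hom group_hom_zero_minus(2)[of \<psi>, OF hom])
        moreover have "\<psi> a \<in> D" "\<psi> b \<in> W2" using ab(1) zs(2) KD by auto
        ultimately show "h \<in> W1" using W2(3) by simp
      qed
      ultimately show "sum_list (map (\<lambda>(a, b). a + b - a - b) zs) \<in> \<psi> -` W"
        using W1(3)[rule_format, of "map \<psi> (map (\<lambda>(a, b). a + b - a - b) zs)"] zs(1) by simp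
    qed
    ultimately show "0 \<in> interior (\<psi> -` W)" using interior_mono by blast
  qed
qed

end
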